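(* Let $k\geq 1$, let $\Lambda$ be a row-finite $k$-graph with no sources, and let $R$ be a commutative ring with $1$. Let $\mathrm{KP}_R(\Lambda)$ be the Kumjian-Pask algebra of $\Lambda$ over $R$ and $Z(\mathrm{KP}_R(\Lambda))$ its center. (1) If $\Lambda$ is aperiodic and cofinal and $\Lambda^0$ is finite, then $\mathrm{KP}_R(\Lambda)$ has an identity $1_{\mathrm{KP}_R(\Lambda)}$ and $Z(\mathrm{KP}_R(\Lambda))=R\,1_{\mathrm{KP}_R(\Lambda)}=\{r1_{\mathrm{KP}_R(\Lambda)}: r\in R\}$. (2) If $\Lambda$ is cofinal and $\Lambda^0$ is infinite, then $Z(\mathrm{KP}_R(\Lambda))=\{0\}$.
   Context: $\mathbb{N}^k$ is regarded as a category with one object, composition being addition. A $k$-graph is a countable category $\Lambda$ together with a functor $d:\Lambda\to\mathbb{N}^k$ (the degree) with the unique factorization property: whenever $d(\lambda)=m+n$ there are unique $\mu,\nu\in\Lambda$ with $d(\mu)=m$, $d(\nu)=n$, $\lambda=\mu\nu$. Objects are identified with morphisms of degree $0$ and called vertices; $\Lambda^0$ is the set of vertices, $\Lambda^n=d^{-1}(n)$, $r,s$ are the range and source maps, and $\lambda\mu$ is defined when $s(\lambda)=r(\mu)$. For $v\in\Lambda^0$, $v\Lambda^n=\{\lambda\in\Lambda^n:r(\lambda)=v\}$. $\Lambda$ is row-finite if $v\Lambda^n$ is finite for all $v,n$, and has no sources if $v\Lambda^n\neq\emptyset$ for all $v,n$. For $\lambda\in\Lambda$ and $0\le m\le n\le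 d(\lambda)$, $\lambda(m,n)$ denotes the unique path of degree $n-m$ with $\lambda=\lambda'\lambda(m,n)\lambda''$ where $d(\lambda')=m$, $d(\lambda'')=d(\lambda)-n$. Aperiodic: for every $v\in\Lambda^0$ and $m\neq n\in\mathbb{N}^k$ there is $\lambda$ with $r(\lambda)=v$, $d(\lambda)\geq m\vee n$ and $\lambda(m,m+d(\lambda)-(m\vee n))\neq\lambda(n,n+d(\lambda)-(m\vee n))$. Let $\Omega_k$ be the $k$-graph with objects $\mathbb{N}^k$, morphisms $\{(m,n):m\le n\}$, $r(m,n)=m$, $s(m,n)=n$, $d(m,n)=n-m$. An infinite path is a degree-preserving functor $x:\Omega_k\to\Lambda$; write $x(m)=x(m,m)$. $\Lambda$ is cofinal if for every infinite path $x$ and every $v\in\Lambda^0$ there is $m\in\mathbb{N}^k$ and a path $\lambda$ with $r(\lambda)=v$, $s(\lambda)=x(m)$. Let $\Lambda^{\neq0}$ be the paths of nonzero degree and introduce a formal symbol $\lambda^*$ for each $\lambda\in\Lambda^{\neq 0}$. A Kumjian-Pask $\Lambda$-family in an $R$-algebra $A$ consists of $P:\Lambda^0\to A$ and $S:\Lambda^{\neq0}\cup\{\lambda^*\}\to A$ such that: (KP1) the $P_v$ are mutually orthogonal idempotents; (KP2) for $\lambda,\mu\in\Lambda^{\ne0}$ with $r(\mu)=s(\lambda)$: $S_\lambda S_\mu=S_{\lambda\mu}$, $S_{\mu^*}S_{\lambda^*}=S_{(\lambda\mu)^*}$, $P_{r(\lambda)}S_\lambda=S_\lambda=S_\lambda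 P_{s(\lambda)}$, $P_{s(\lambda)}S_{\lambda^*}=S_{\lambda^*}=S_{\lambda^*}P_{r(\lambda)}$; (KP3) for $\lambda,\mu\in\Lambda^{\neq0}$ with $d(\lambda)=d(\mu)$, $S_{\lambda^*}S_\mu=\delta_{\lambda,\mu}P_{s(\lambda)}$; (KP4) for $v\in\Lambda^0$ and $n\neq0$, $P_v=\sum_{\lambda\in v\Lambda^n}S_\lambda S_{\lambda^*}$. $\mathrm{KP}_R(\Lambda)$ is the $R$-algebra generated by a Kumjian-Pask family $(p,s)$ that is universal: every Kumjian-Pask family in an $R$-algebra $A$ is the image of $(p,s)$ under a unique $R$-algebra homomorphism $\mathrm{KP}_R(\Lambda)\to A$. *)

theory Defs
  imports Main "HOL-Library.Countable_Set"
begin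

section \<open>Degrees: elements of N^k, encoded as functions nat => nat vanishing from k on\<close>

definition Nk :: "nat \<Rightarrow> (nat \<Rightarrow> nat) set" where
  "Nk k = {n. \<forall>i\<ge>k. n i = 0}"

definition dadd :: "(nat \<Rightarrow> nat) \<Rightarrow> (nat \<Rightarrow> nat) \<Rightarrow> (nat \<Rightarrow> nat)" where
  "dadd m n = (\<lambda>i. m i + n i)"

definition dsub :: "(nat \<Rightarrow> nat) \<Rightarrow> (nat \<Rightarrow> nat) \<Rightarrow> (nat \<Rightarrow> nat)" where
  "dsub m n = (\<lambda>i. m i - n i)"

definition dzero :: "nat \<Rightarrow> nat" where
  "dzero = (\<lambda>i. 0)"

(* the order on degrees is the pointwise order (le_fun), and m \<or> n is the pointwise
   maximum "sup m n" (sup_fun) *)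

record 'a kgraph =
  kmor :: "'a set"
  kcomp :: "'a \<Rightarrow> 'a \<Rightarrow> 'a"       (* composition (lambda mu), meaningful if s lambda = r mu *)
  krng :: "'a \<Rightarrow> 'a"
  ksrc :: "'a \<Rightarrow> 'a"
  kdeg :: "'a \<Rightarrow> nat \<Rightarrow> nat"

(* objects are identified with the morphisms of degree 0 *)
definition kvert :: "'a kgraph \<Rightarrow> 'a set" where
  "kvert G = {v \<in> kmor G. kdeg G v = dzero}"

definition is_kgraph :: "nat \<Rightarrow> 'a kgraph \<Rightarrow> bool" where
  "is_kgraph k G \<longleftrightarrow>
     countable (kmor G) \<and>
     (\<forall>l\<in>kmor G. kdeg G l \<in> Nk k) \<and>
     (\<forall>l\<in>kmor G. krng G l \<in> kvert G \<and> ksrc G l \<in> kvert G) \<and>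
     (\<forall>v\<in>kvert G. krng G v = v \<and> ksrc G v = v) \<and>
     (\<forall>l\<in>kmor G. kcomp G (krng G l) l = l \<and> kcomp G l (ksrc G l) = l) \<and>
     (\<forall>l\<in>kmor G. \<forall>m\<in>kmor G. ksrc G l = krng G m \<longrightarrow>
         kcomp G l m \<in> kmor G \<and> krng G (kcomp G l m) = krng G l \<and>
         ksrc G (kcomp G l m) = ksrc G m \<and>
         kdeg G (kcomp G l m) = dadd (kdeg G l) (kdeg G m)) \<and>
     (\<forall>l\<in>kmor G. \<forall>m\<in>kmor G. \<forall>n\<in>kmor G.
         ksrc G l = krng G m \<longrightarrow> ksrc G m = krng G n \<longrightarrow>
         kcomp G (kcomp G l m) n = kcomp G l (kcomp G m n)) \<and>
     (\<forall>l\<in>kmor G. \<forall>m\<in>Nk k. \<forall>n\<in>Nk k. kdeg G l = dadd m n \<longrightarrow>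
         (\<exists>!p. fst p \<in> kmor G \<and> snd p \<in> kmor G \<and> ksrc G (fst p) = krng G (snd p) \<and>
               kdeg G (fst p) = m \<and> kdeg G (snd p) = n \<and> kcomp G (fst p) (snd p) = l))"

definition kpaths_from :: "'a kgraph \<Rightarrow> 'a \<Rightarrow> (nat \<Rightarrow> nat) \<Rightarrow> 'a set" where
  "kpaths_from G v n = {l \<in> kmor G. krng G l = v \<and> kdeg G l = n}"

definition row_finite :: "nat \<Rightarrow> 'a kgraph \<Rightarrow> bool" where
  "row_finite k G \<longleftrightarrow> (\<forall>v\<in>kvert G. \<forall>n\<in>Nk k. finite (kpaths_from G v n))"

definition no_sources :: "nat \<Rightarrow> 'a kgraph \<Rightarrow> bool" where
  "no_sources k G \<longleftrightarrow> (\<forall>v\<in>kvert G. \<forall>n\<in>Nk k. kpaths_from G v n \<noteq> {})"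

(* lambda(m,n) for 0 <= m <= n <= d(lambda) *)
definition kseg :: "'a kgraph \<Rightarrow> 'a \<Rightarrow> (nat \<Rightarrow> nat) \<Rightarrow> (nat \<Rightarrow> nat) \<Rightarrow> 'a" where
  "kseg G l m n = (THE mu. mu \<in> kmor G \<and> kdeg G mu = dsub n m \<and>
      (\<exists>l1 l2. l1 \<in> kmor G \<and> l2 \<in> kmor G \<and> kdeg G l1 = m \<and> kdeg G l2 = dsub (kdeg G l) n \<and>
              ksrc G l1 = krng G mu \<and> ksrc G mu = krng G l2 \<and>
              l = kcomp G (kcomp G l1 mu) l2))"

definition aperiodic :: "nat \<Rightarrow> 'a kgraph \<Rightarrow> bool" where
  "aperiodic k G \<longleftrightarrow>
     (\<forall>v\<in>kvert G. \<forall>m\<in>Nk k. \<forall>n\<in>Nk k. m \<noteq> n \<longrightarrow>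
        (\<exists>l\<in>kmor G. krng G l = v \<and> sup m n \<le> kdeg G l \<and>
           kseg G l m (dadd m (dsub (kdeg G l) (sup m n))) \<noteq>
           kseg G l n (dadd n (dsub (kdeg G l) (sup m n)))))"

(* infinite path: degree preserving functor x : Omega_k -> Lambda, x m n = x(m,n) *)
definition inf_path :: "nat \<Rightarrow> 'a kgraph \<Rightarrow> ((nat \<Rightarrow> nat) \<Rightarrow> (nat \<Rightarrow> nat) \<Rightarrow> 'a) \<Rightarrow> bool" where
  "inf_path k G x \<longleftrightarrow>
     (\<forall>m\<in>Nk k. \<forall>n\<in>Nk k. m \<le> n \<longrightarrow>
        x m n \<in> kmor G \<and> kdeg G (x m n) = dsub n m \<and>
        krng G (x m n) = x m m \<and> ksrc G (x m n) = x n n) \<and>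
     (\<forall>m\<in>Nk k. \<forall>n\<in>Nk k. \<forall>p\<in>Nk k. m \<le> n \<longrightarrow> n \<le> p \<longrightarrow>
        kcomp G (x m n) (x n p) = x m p)"

definition cofinal :: "nat \<Rightarrow> 'a kgraph \<Rightarrow> bool" where
  "cofinal k G \<longleftrightarrow>
     (\<forall>x. inf_path k G x \<longrightarrow>
        (\<forall>v\<in>kvert G. \<exists>m\<in>Nk k. \<exists>l\<in>kmor G. krng G l = v \<and> ksrc G l = x m m))"

(* elements: finitely supported functions on words, vanishing on the empty word *)
type_synonym ('g, 'r) fa = "'g list \<Rightarrow> 'r"

definition fa_carrier :: "('g, 'r::comm_ring_1) fa set" where
  "fa_carrier = {f. finite {w. f w \<noteq> 0} \<and> f [] = 0}"

definition fa_zero :: "('g, 'r::comm_ring_1) fa" where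
  "fa_zero = (\<lambda>w. 0)"

definition fa_add :: "('g, 'r::comm_ring_1) fa \<Rightarrow> ('g, 'r) fa \<Rightarrow> ('g, 'r) fa" where
  "fa_add f g = (\<lambda>w. f w + g w)"

definition fa_minus :: "('g, 'r::comm_ring_1) fa \<Rightarrow> ('g, 'r) fa \<Rightarrow> ('g, 'r) fa" where
  "fa_minus f g = (\<lambda>w. f w - g w)"

definition fa_smult :: "'r::comm_ring_1 \<Rightarrow> ('g, 'r) fa \<Rightarrow> ('g, 'r) fa" where
  "fa_smult r f = (\<lambda>w. r * f w)"

definition fa_mult :: "('g, 'r::comm_ring_1) fa \<Rightarrow> ('g, 'r) fa \<Rightarrow> ('g, 'r) fa" where
  "fa_mult f g = (\<lambda>w. \<Sum>i\<le>length w. f (take i w) * g (drop i w))"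

definition fa_sum :: "('b \<Rightarrow> ('g, 'r::comm_ring_1) fa) \<Rightarrow> 'b set \<Rightarrow> ('g, 'r) fa" where
  "fa_sum F A = (\<lambda>w. \<Sum>x\<in>A. F x w)"

definition fa_gen :: "'g \<Rightarrow> ('g, 'r::comm_ring_1) fa" where
  "fa_gen g = (\<lambda>w. if w = [g] then 1 else 0)"

inductive_set fa_ideal :: "('g, 'r::comm_ring_1) fa set \<Rightarrow> ('g, 'r) fa set"
  for X :: "('g, 'r) fa set" where
  base: "x \<in> X \<Longrightarrow> x \<in> fa_ideal X"
| zero: "fa_zero \<in> fa_ideal X"
| add: "x \<in> fa_ideal X \<Longrightarrow> y \<in> fa_ideal X \<Longrightarrow> fa_add x y \<in> fa_ideal X"
| smult: "x \<in> fa_ideal X \<Longrightarrow> fa_smult r x \<in> fa_ideal X"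
| left: "a \<in> fa_carrier \<Longrightarrow> x \<in> fa_ideal X \<Longrightarrow> fa_mult a x \<in> fa_ideal X"
| right: "a \<in> fa_carrier \<Longrightarrow> x \<in> fa_ideal X \<Longrightarrow> fa_mult x a \<in> fa_ideal X"

section \<open>The Kumjian-Pask algebra KP_R(Lambda) = free algebra / Kumjian-Pask relations\<close>

(* GP v = p_v,  GS l = s_l,  GT l = s_{l^*} *)
datatype 'a kpgen = GP 'a | GS 'a | GT 'a

definition nonzero_paths :: "'a kgraph \<Rightarrow> 'a set" where
  "nonzero_paths G = {l \<in> kmor G. kdeg G l \<noteq> dzero}"

definition kp_relations :: "nat \<Rightarrow> 'a kgraph \<Rightarrow> ('a kpgen, 'r::comm_ring_1) fa set" where
  "kp_relations k G =
     (let p = (\<lambda>v. fa_gen (GP v)); s = (\<lambda>l. fa_gen (GS l)); t = (\<lambda>l. fa_gen (GT l));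
          L = nonzero_paths G; V = kvert G in
     \<comment> \<open>generators are indexed only by vertices and nonzero-degree paths\<close>
     {p v | v. v \<notin> V} \<union> {s l | l. l \<notin> L} \<union> {t l | l. l \<notin> L} \<union>
     \<comment> \<open>(KP1)\<close>
     {fa_minus (fa_mult (p v) (p w)) (if v = w then p v else fa_zero) | v w. v \<in> V \<and> w \<in> V} \<union>
     \<comment> \<open>(KP2)\<close>
     {fa_minus (fa_mult (s l) (s m)) (s (kcomp G l m)) | l m. l \<in> L \<and> m \<in> L \<and> krng G m = ksrc G l} \<union>
     {fa_minus (fa_mult (t m) (t l)) (t (kcomp G l m)) | l m. l \<in> L \<and> m \<in> L \<and> krng G m = ksrc G l} \<union>
     {fa_minus (fa_mult (p (krng G l)) (s l)) (s l) | l. l \<in> L} \<union>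
     {fa_minus (fa_mult (s l) (p (ksrc G l))) (s l) | l. l \<in> L} \<union>
     {fa_minus (fa_mult (p (ksrc G l)) (t l)) (t l) | l. l \<in> L} \<union>
     {fa_minus (fa_mult (t l) (p (krng G l))) (t l) | l. l \<in> L} \<union>
     \<comment> \<open>(KP3)\<close>
     {fa_minus (fa_mult (t l) (s m)) (if l = m then p (ksrc G l) else fa_zero)
        | l m. l \<in> L \<and> m \<in> L \<and> kdeg G l = kdeg G m} \<union>
     \<comment> \<open>(KP4)\<close>
     {fa_minus (p v) (fa_sum (\<lambda>l. fa_mult (s l) (t l)) (kpaths_from G v n))
        | v n. v \<in> V \<and> n \<in> Nk k \<and> n \<noteq> dzero})"

definition kp_ideal :: "nat \<Rightarrow> 'a kgraph \<Rightarrow> ('a kpgen, 'r::comm_ring_1) fa set" where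
  "kp_ideal k G = fa_ideal (kp_relations k G)"

definition kp_eq :: "nat \<Rightarrow> 'a kgraph \<Rightarrow> ('a kpgen, 'r::comm_ring_1) fa \<Rightarrow> ('a kpgen, 'r) fa \<Rightarrow> bool" where
  "kp_eq k G a b \<longleftrightarrow> fa_minus a b \<in> kp_ideal k G"

(* representatives of the elements of the center Z(KP_R(Lambda)) *)
definition kp_center :: "nat \<Rightarrow> 'a kgraph \<Rightarrow> ('a kpgen, 'r::comm_ring_1) fa set" where
  "kp_center k G = {a \<in> fa_carrier. \<forall>b\<in>fa_carrier. kp_eq k G (fa_mult a b) (fa_mult b a)}"

definition kp_is_identity :: "nat \<Rightarrow> 'a kgraph \<Rightarrow> ('a kpgen, 'r::comm_ring_1) fa \<Rightarrow> bool" where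
  "kp_is_identity k G e \<longleftrightarrow> e \<in> fa_carrier \<and>
     (\<forall>b\<in>fa_carrier. kp_eq k G (fa_mult e b) b \<and> kp_eq k G (fa_mult b e) b)"

end

(* For a central element a and a scalar c, the vertices v with a p_v = c p_v form a hereditary and
   saturated set, which by cofinality is empty or everything. If there are infinitely many vertices,
   a p_v = 0 for all but finitely many v, so a = 0. If there are finitely many, aperiodicity yields
   a path l along which the normal form of a collapses: s_l^* a s_l = c p_(s l). By centrality the
   left-hand side is a p_(s l), so a acts as c at the vertex s l, hence everywhere, and a = c 1. *)

theory Submission
  imports Defs "HOL.Modules"
begin

section \<open>Degrees and paths\<close>

text \<open>The computations take place in an arbitrary \<open>ring\<close> with a Kumjian-Pask
  family and use the products \<open>S a * T b\<close> only as a spanning set. One device drives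
  them: in \<open>T a * S b\<close>, expand \<open>p (r b)\<close> over all paths of degree
  \<open>sup (d a) (d b)\<close>. Each such path is long enough to be compared with both a and b,
  and unique factorization with (KP3) then evaluates every factor.

  The collapse along l comes from the same comparison. If l is long enough,
  \<open>T l * (S a * T b) * S l\<close> is zero, or it equals \<open>T \<mu> * S \<nu>\<close>
  where l factors both as a followed by \<mu> and as b followed by \<nu>. If \<mu> and \<nu> have
  equal degrees they coincide and leave a vertex idempotent. Otherwise aperiodicity prolongs l until
  the two paths have no common extension, and the product vanishes. A summand once reduced to a
  multiple of a vertex idempotent stays so under further prolongation, so the summands are treated
  in turn along a growing path.

  A scalar travels forward along l through \<open>T l * S l = p (src l)\<close>, and backward
  through (KP4) in degree (1,...,1).\<close>

lemma Nk_closed [simp]: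
  "dzero \<in> Nk k"
  "m \<in> Nk k \<Longrightarrow> n \<in> Nk k \<Longrightarrow> dadd m n \<in> Nk k"
  "m \<in> Nk k \<Longrightarrow> dsub m n \<in> Nk k"
  "m \<in> Nk k \<Longrightarrow> n \<in> Nk k \<Longrightarrow> sup m n \<in> Nk k"
  by (auto simp: Nk_def dadd_def dsub_def dzero_def)

lemma dadd_dsub [simp]: "m \<le> n \<Longrightarrow> dadd m (dsub n m) = n"
  by (auto simp: dadd_def dsub_def le_fun_def)

lemma dsub_dadd [simp]: "dsub (dadd m n) m = n"
  by (auto simp: dadd_def dsub_def)

lemma dadd_dzero [simp]: "dadd m dzero = m" "dadd dzero m = m"
  by (auto simp: dadd_def dzero_def)

lemma dsub_self [simp]: "dsub m m = dzero"
  by (auto simp: dsub_def dzero_def)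

lemma dadd_assoc: "dadd (dadd l m) n = dadd l (dadd m n)"
  by (auto simp: dadd_def)

lemma dadd_eq_dzero_iff [simp]: "dadd m n = dzero \<longleftrightarrow> m = dzero \<and> n = dzero"
  by (auto simp: dadd_def dzero_def fun_eq_iff)

lemma dadd_left_cancel [simp]: "dadd m n = dadd m n' \<longleftrightarrow> n = n'"
  by (auto simp: dadd_def fun_eq_iff)

lemma le_dadd [simp]: "m \<le> dadd m n" "n \<le> dadd m n"
  by (auto simp: dadd_def le_fun_def)

locale higher_rank_graph =
  fixes k :: nat and G :: "'a kgraph"
  assumes is_kgraph: "is_kgraph k G"
begin

abbreviation "\<Lambda> \<equiv> kmor G"
abbreviation "V \<equiv> kvert G"
abbreviation "r \<equiv> krng G"
abbreviation "src \<equiv> ksrc G"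
abbreviation "d \<equiv> kdeg G"
abbreviation comp (infixl "\<odot>" 70) where "comp \<equiv> kcomp G"

lemmas kgraph_axioms = is_kgraph[unfolded is_kgraph_def]

lemma deg_Nk [simp]: "l \<in> \<Lambda> \<Longrightarrow> d l \<in> Nk k"
  by (rule kgraph_axioms[THEN conjunct2, THEN conjunct1, rule_format])

lemma rng_src_vert [simp]:
  assumes "l \<in> \<Lambda>"
  shows "r l \<in> V" "src l \<in> V"
  using kgraph_axioms[THEN conjunct2, THEN conjunct2, THEN conjunct1, rule_format, OF assms]
  by blast+

lemma vert_mor [simp]: "v \<in> V \<Longrightarrow> v \<in> \<Lambda>"
  unfolding kvert_def by blast

lemma vertI: "v \<in> \<Lambda> \<Longrightarrow> d v = dzero \<Longrightarrow> v \<in> V"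
  unfolding kvert_def by blast

lemma vert_deg [simp]: "v \<in> V \<Longrightarrow> d v = dzero"
  unfolding kvert_def by blast

lemma vert_rng_src [simp]:
  assumes "v \<in> V"
  shows "r v = v" "src v = v"
  using kgraph_axioms[THEN conjunct2, THEN conjunct2, THEN conjunct2, THEN conjunct1,
      rule_format, OF assms]
  by blast+

lemma comp_unit [simp]:
  assumes "l \<in> \<Lambda>"
  shows "r l \<odot> l = l" "l \<odot> src l = l"
  using kgraph_axioms[THEN conjunct2, THEN conjunct2, THEN conjunct2, THEN conjunct2,
      THEN conjunct1, rule_format, OF assms]
  by blast+

lemma comp_closed [simp]:
  assumes "l \<in> \<Lambda>" "m \<in> \<Lambda>" "src l = r m"
  shows "l \<odot> m \<in> \<Lambda>" "r (l \<odot> m) = r l" "src (l \<odot> m) = src m" "d (l \<odot> m) = dadd (d l) (d m)"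
  using kgraph_axioms[THEN conjunct2, THEN conjunct2, THEN conjunct2, THEN conjunct2,
      THEN conjunct2, THEN conjunct1, rule_format, OF assms]
  by blast+

lemma comp_assoc:
  "l \<in> \<Lambda> \<Longrightarrow> m \<in> \<Lambda> \<Longrightarrow> n \<in> \<Lambda> \<Longrightarrow> src l = r m \<Longrightarrow> src m = r n \<Longrightarrow> (l \<odot> m) \<odot> n = l \<odot> (m \<odot> n)"
  by (rule kgraph_axioms[THEN conjunct2, THEN conjunct2, THEN conjunct2, THEN conjunct2,
      THEN conjunct2, THEN conjunct2, THEN conjunct1, rule_format])

lemma factor_ex1:
  "l \<in> \<Lambda> \<Longrightarrow> m \<in> Nk k \<Longrightarrow> n \<in> Nk k \<Longrightarrow> d l = dadd m n \<Longrightarrow>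
     \<exists>!p. fst p \<in> \<Lambda> \<and> snd p \<in> \<Lambda> \<and> src (fst p) = r (snd p) \<and>
               d (fst p) = m \<and> d (snd p) = n \<and> fst p \<odot> snd p = l"
  by (rule kgraph_axioms[THEN conjunct2, THEN conjunct2, THEN conjunct2, THEN conjunct2,
      THEN conjunct2, THEN conjunct2, THEN conjunct2, rule_format])

lemma factor:
  assumes "l \<in> \<Lambda>" "m \<in> Nk k" "m \<le> d l"
  obtains a b where "a \<in> \<Lambda>" "b \<in> \<Lambda>" "src a = r b" "d a = m" "d b = dsub (d l) m" "l = a \<odot> b"
proof -
  have "d l = dadd m (dsub (d l) m)" using assms by simp
  then obtain p where "fst p \<in> \<Lambda> \<and> snd p \<in> \<Lambda> \<and> src (fst p) = r (snd p) \<and>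
      d (fst p) = m \<and> d (snd p) = dsub (d l) m \<and> fst p \<odot> snd p = l"
    using factor_ex1[OF assms(1,2), of "dsub (d l) m"] assms by auto
  then show thesis using that by blast
qed

lemma factor_unique:
  assumes "a \<in> \<Lambda>" "b \<in> \<Lambda>" "src a = r b" "a' \<in> \<Lambda>" "b' \<in> \<Lambda>" "src a' = r b'"
    and "d a = d a'" "a \<odot> b = a' \<odot> b'"
  shows "a = a'" "b = b'"
proof -
  have "dadd (d a) (d b) = dadd (d a') (d b')"
    using assms comp_closed(4) by metis
  then have "d b = d b'" using assms by simp
  \<comment> \<open>The uniqueness half of \<open>factor_ex1\<close>, put in a form that can be
    instantiated at two explicit pairs.\<close>
  moreover have "x = y" if "\<exists>!z. P z" "P x" "P y" for P and x y :: "'a \<times> 'a"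
    using that by blast
  note this[OF factor_ex1[of "a \<odot> b" "d a" "d b"], of "(a, b)" "(a', b')"]
  ultimately have "(a, b) = (a', b')"
    using assms by simp
  then show "a = a'" "b = b'" by auto
qed

section \<open>Segments of paths\<close>

lemma kseg_eqI:
  assumes "l1 \<in> \<Lambda>" "mu \<in> \<Lambda>" "l2 \<in> \<Lambda>" "src l1 = r mu" "src mu = r l2"
    and "d l1 = m" "dadd m (d mu) = n"
  shows "kseg G (l1 \<odot> mu \<odot> l2) m n = mu"
  unfolding kseg_def
proof (rule the_equality)
  have *: "d (l1 \<odot> mu \<odot> l2) = dadd n (d l2)" using assms by (simp add: dadd_assoc)
  show "mu \<in> \<Lambda> \<and> d mu = dsub n m \<and>
      (\<exists>l1' l2'. l1' \<in> \<Lambda> \<and> l2' \<in> \<Lambda> \<and> d l1' = m \<and> d l2' = dsub (d (l1 \<odot> mu \<odot> l2)) n \<and>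
              src l1' = r mu \<and> src mu = r l2' \<and> l1 \<odot> mu \<odot> l2 = l1' \<odot> mu \<odot> l2')"
    using assms * by (intro conjI exI[of _ l1] exI[of _ l2]) auto
  fix mu'
  assume "mu' \<in> \<Lambda> \<and> d mu' = dsub n m \<and>
      (\<exists>l1' l2'. l1' \<in> \<Lambda> \<and> l2' \<in> \<Lambda> \<and> d l1' = m \<and> d l2' = dsub (d (l1 \<odot> mu \<odot> l2)) n \<and>
              src l1' = r mu' \<and> src mu' = r l2' \<and> l1 \<odot> mu \<odot> l2 = l1' \<odot> mu' \<odot> l2')"
  then obtain l1' l2' where h: "mu' \<in> \<Lambda>" "d mu' = dsub n m" "l1' \<in> \<Lambda>" "l2' \<in> \<Lambda>" "d l1' = m"
      "src l1' = r mu'" "src mu' = r l2'" "l1 \<odot> mu \<odot> l2 = l1' \<odot> mu' \<odot> l2'" by blast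
  have dm: "d mu' = d mu" using h assms by auto
  \<comment> \<open>Unique factorization is applied twice: first to split off the tails
    \<open>l2\<close> and \<open>l2'\<close>, then to split off the heads.\<close>
  have "l1 \<odot> mu = l1' \<odot> mu'"
    by (rule factor_unique(1)[of _ l2 _ l2']) (use h assms dm in auto)
  then show "mu' = mu"
    using factor_unique(2)[of l1 mu l1' mu'] h assms by auto
qed

lemma factor3:
  assumes "l \<in> \<Lambda>" "m \<in> Nk k" "n \<in> Nk k" "m \<le> n" "n \<le> d l"
  obtains a b c where "a \<in> \<Lambda>" "b \<in> \<Lambda>" "c \<in> \<Lambda>" "src a = r b" "src b = r c"
    "d a = m" "d b = dsub n m" "l = a \<odot> b \<odot> c"
proof -
  obtain e c where e: "e \<in> \<Lambda>" "c \<in> \<Lambda>" "src e = r c" "d e = n" "d c = dsub (d l) n" "l = e \<odot> c"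
    using factor[OF assms(1,3,5)] .
  obtain a b where "a \<in> \<Lambda>" "b \<in> \<Lambda>" "src a = r b" "d a = m" "d b = dsub (d e) m" "e = a \<odot> b"
    using factor[OF e(1) assms(2)] e(4) assms(4) by blast
  then show thesis using e that[of a b c] by auto
qed

lemma kseg_closed:
  assumes "l \<in> \<Lambda>" "m \<in> Nk k" "n \<in> Nk k" "m \<le> n" "n \<le> d l"
  shows "kseg G l m n \<in> \<Lambda>" "d (kseg G l m n) = dsub n m"
proof -
  obtain a b c where h: "a \<in> \<Lambda>" "b \<in> \<Lambda>" "c \<in> \<Lambda>" "src a = r b" "src b = r c"
    "d a = m" "d b = dsub n m" "l = a \<odot> b \<odot> c"
    using factor3[OF assms] .
  have "kseg G l m n = b" unfolding h(8) by (rule kseg_eqI) (use h assms in auto)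
  then show "kseg G l m n \<in> \<Lambda>" "d (kseg G l m n) = dsub n m" using h by auto
qed

text \<open>The segment from m to q is cut once more at n, giving four factors of l; every segment
  involved can then be read off from a suitable bracketing by \<open>kseg_eqI\<close>.\<close>

lemma kseg_comp:
  assumes "l \<in> \<Lambda>" "m \<in> Nk k" "n \<in> Nk k" "q \<in> Nk k" "m \<le> n" "n \<le> q" "q \<le> d l"
  shows "src (kseg G l m n) = r (kseg G l n q)" "kseg G l m n \<odot> kseg G l n q = kseg G l m q"
proof -
  obtain a b c where h: "a \<in> \<Lambda>" "b \<in> \<Lambda>" "c \<in> \<Lambda>" "src a = r b" "src b = r c"
    "d a = m" "d b = dsub q m" "l = a \<odot> b \<odot> c"
    using factor3[OF assms(1,2,4) order_trans[OF assms(5,6)] assms(7)] .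
  have "dsub n m \<le> dsub q m" using assms by (auto simp: dsub_def le_fun_def intro: diff_le_mono)
  then have le: "dsub n m \<le> d b" unfolding h(7) .
  obtain b1 b2 where b: "b1 \<in> \<Lambda>" "b2 \<in> \<Lambda>" "src b1 = r b2" "d b1 = dsub n m"
      "d b2 = dsub (d b) (dsub n m)" "b = b1 \<odot> b2"
    using factor[OF h(2) Nk_closed(3)[OF assms(3)] le] .
  have "n i + (q i - m i - (n i - m i)) = q i" for i
    using le_funD[OF assms(5), of i] le_funD[OF assms(6), of i] by linarith
  then have db2: "dadd n (d b2) = q"
    unfolding b(5) h(7) dadd_def dsub_def by (rule ext)
  have rb: "r b = r b1" "src b = src b2" unfolding b(6) using b(1-3) by simp_all
  have ab: "a \<odot> b1 \<in> \<Lambda>" "src (a \<odot> b1) = r b2" "d (a \<odot> b1) = n"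
    using h(1,4,6) b(1,3,4) rb assms(5) by simp_all
  have bc: "b2 \<odot> c \<in> \<Lambda>" "r (b2 \<odot> c) = src b1"
    using h(3,5) b(2,3) rb by simp_all
  \<comment> \<open>Two bracketings of the same product: \<open>l1\<close> has \<open>b2\<close> as
    its middle factor, \<open>l2\<close> has \<open>b1\<close>.\<close>
  have l1: "l = a \<odot> b1 \<odot> b2 \<odot> c"
    unfolding h(8) b(6) using comp_assoc[of a b1 b2] h(1,4) b(1-3) rb by simp
  have l2: "l = a \<odot> b1 \<odot> (b2 \<odot> c)"
    unfolding l1 using comp_assoc[of "a \<odot> b1" b2 c] ab(1,2) b(2) h(3,5) rb by simp
  have 1: "kseg G l m q = b" unfolding h(8)
    by (rule kseg_eqI) (use h(1-7) order_trans[OF assms(5,6)] in auto)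
  have 2: "kseg G l m n = b1" unfolding l2
    by (rule kseg_eqI) (use h(1,4,6) b(1,4) bc rb assms(5) in auto)
  have 3: "kseg G l n q = b2" unfolding l1
    by (rule kseg_eqI) (use h(3,5) b(2) ab rb db2 in auto)
  show "src (kseg G l m n) = r (kseg G l n q)" "kseg G l m n \<odot> kseg G l n q = kseg G l m q"
    unfolding 1 2 3 by (simp_all add: b(3) flip: b(6))
qed

text \<open>Factor l around the segment; prepending a and appending c only lengthens the outer
  factors and leaves the middle one alone. This shift by \<open>d a\<close> is what moves the
  aperiodicity condition from l to its prolongations.\<close>

lemma kseg_inner:
  assumes "a \<in> \<Lambda>" "l \<in> \<Lambda>" "c \<in> \<Lambda>" "src a = r l" "src l = r c"
    and "m \<in> Nk k" "n \<in> Nk k" "m \<le> n" "n \<le> d l"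
  shows "kseg G (a \<odot> l \<odot> c) (dadd (d a) m) (dadd (d a) n) = kseg G l m n"
proof -
  obtain x b y where h: "x \<in> \<Lambda>" "b \<in> \<Lambda>" "y \<in> \<Lambda>" "src x = r b" "src b = r y"
    "d x = m" "d b = dsub n m" "l = x \<odot> b \<odot> y"
    using factor3[OF assms(2,6,7,8,9)] .
  define e where "e = x \<odot> b"
  have e: "e \<in> \<Lambda>" "r e = r x" "src e = r y" "l = e \<odot> y" using h by (simp_all add: e_def)
  have rl: "r l = r x" "src l = src y" unfolding e(4) using e(1-3) h(3) by simp_all
  have ae: "a \<odot> e = a \<odot> x \<odot> b" "a \<odot> e \<in> \<Lambda>" "src (a \<odot> e) = r y"
    using comp_assoc[of a x b] e(1-3) rl assms(1,4) h(1,2,4) by (simp_all flip: e_def)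
  have ax: "a \<odot> x \<in> \<Lambda>" "src (a \<odot> x) = r b" "d (a \<odot> x) = dadd (d a) m"
    using assms(1,4) h(1,4,6) rl by simp_all
  have yc: "y \<odot> c \<in> \<Lambda>" "r (y \<odot> c) = r y"
    using assms(3,5) h(3) rl by simp_all
  have "kseg G l m n = b" unfolding h(8) by (rule kseg_eqI) (use h(1-7) assms(8) in auto)
  moreover have "a \<odot> l \<odot> c = a \<odot> x \<odot> b \<odot> (y \<odot> c)"
    unfolding e(4) ae(1)[symmetric]
    using comp_assoc[of a e y] comp_assoc[of "a \<odot> e" y c] ae(2,3) e(1-3) rl assms(1,3-5) h(3)
    by simp
  moreover have "kseg G (a \<odot> x \<odot> b \<odot> (y \<odot> c)) (dadd (d a) m) (dadd (d a) n) = b"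
    by (rule kseg_eqI) (use ax yc h(2,5,7) assms(8) in \<open>auto simp: dadd_assoc\<close>)
  ultimately show ?thesis by simp
qed

lemma kseg_prefix:
  assumes "l \<in> \<Lambda>" "c \<in> \<Lambda>" "src l = r c" "m \<in> Nk k" "n \<in> Nk k" "m \<le> n" "n \<le> d l"
  shows "kseg G (l \<odot> c) m n = kseg G l m n"
  using kseg_inner[of "r l" l c m n] assms by simp

text \<open>These are the degenerate cases of \<open>kseg_comp\<close> in which one of the two
  segments has degree zero and hence is a vertex.\<close>

lemma kseg_vertex:
  assumes "l \<in> \<Lambda>" "m \<in> Nk k" "n \<in> Nk k" "m \<le> n" "n \<le> d l"
  shows "r (kseg G l m n) = kseg G l m m" "src (kseg G l m n) = kseg G l n n"
proof -
  have V: "kseg G l m m \<in> V" "kseg G l n n \<in> V"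
    using kseg_closed[of l m m] kseg_closed[of l n n] assms order_trans[of m n "d l"]
    by (auto intro!: vertI)
  show "r (kseg G l m n) = kseg G l m m" "src (kseg G l m n) = kseg G l n n"
    using kseg_comp[of l m m n] kseg_comp[of l m n n] assms V by auto
qed

end

section \<open>Infinite paths from blocks of degree (1,...,1), and cofinality\<close>

definition diag :: "nat \<Rightarrow> nat \<Rightarrow> nat \<Rightarrow> nat" where
  "diag k N = (\<lambda>i. if i < k then N else 0)"

lemma diag_Nk [simp]: "diag k N \<in> Nk k"
  by (simp add: diag_def Nk_def)

context higher_rank_graph
begin

primrec concat_path :: "(nat \<Rightarrow> 'a) \<Rightarrow> nat \<Rightarrow> 'a" where
  "concat_path f 0 = r (f 0)"
| "concat_path f (Suc N) = concat_path f N \<odot> f N"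

lemma concat_path:
  assumes "\<And>N. f N \<in> \<Lambda>" "\<And>N. d (f N) = diag k 1" "\<And>N. src (f N) = r (f (Suc N))"
  shows "concat_path f N \<in> \<Lambda> \<and> d (concat_path f N) = diag k N \<and> src (concat_path f N) = r (f N)"
proof (induction N)
  case 0
  then show ?case using assms by (simp add: diag_def dzero_def)
next
  case (Suc N)
  then show ?case using assms by (auto simp: diag_def dadd_def)
qed

text \<open>Segments already determined by N blocks do not change when blocks are appended; this
  makes the infinite path below well defined.\<close>

lemma kseg_concat_path_mono:
  assumes f: "\<And>N. f N \<in> \<Lambda>" "\<And>N. d (f N) = diag k 1" "\<And>N. src (f N) = r (f (Suc N))"
    and "m \<in> Nk k" "n \<in> Nk k" "m \<le> n" "n \<le> diag k N" "N \<le> M"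
  shows "kseg G (concat_path f M) m n = kseg G (concat_path f N) m n"
  using \<open>N \<le> M\<close>
proof (induction M rule: dec_induct)
  case (step M)
  note c = concat_path[of f M, OF f]
  have "diag k N \<le> diag k M" using \<open>N \<le> M\<close> by (simp add: diag_def le_fun_def)
  with \<open>n \<le> diag k N\<close> have "n \<le> diag k M" by (rule order_trans)
  then show ?case
    using kseg_prefix[of "concat_path f M" "f M" m n] c f assms step by simp
qed simp

text \<open>The segments of ever longer finite products fit together to a functor. The second
  conclusion says that every vertex on the infinite path leads on to the end of some block, so a
  hereditary set containing the vertex also contains that end.\<close>

lemma inf_path_exists:
  assumes f: "\<And>N. f N \<in> \<Lambda>" "\<And>N. d (f N) = diag k 1" "\<And>N. src (f N) = r (f (Suc N))"
  obtains x where "inf_path k G x"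
    "\<And>m. m \<in> Nk k \<Longrightarrow> \<exists>l\<in>\<Lambda>. \<exists>N. r l = x m m \<and> src l = src (f N)"
proof -
  define c where "c = concat_path f"
  have c: "c N \<in> \<Lambda>" "d (c N) = diag k N" "src (c N) = r (f N)" for N
    using concat_path[of f N, OF f] by (auto simp: c_def)
  \<comment> \<open>The coordinate sum is a convenient monotone bound for all coordinates:
    \<open>B n\<close> blocks suffice to reach degree n.\<close>
  define B where "B n = sum n {..<k}" for n :: "nat \<Rightarrow> nat"
  have B: "n \<le> diag k (B n)" if "n \<in> Nk k" for n
    using that by (auto simp: B_def diag_def le_fun_def Nk_def intro: member_le_sum)
  have B_mono: "B m \<le> B n" if "m \<le> n" for m n
    using that by (auto simp: B_def le_fun_def intro: sum_mono)
  define x where "x m n = kseg G (c (B n)) m n" for m n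
  have x_eq: "x m n = kseg G (c M) m n" if "m \<in> Nk k" "n \<in> Nk k" "m \<le> n" "B n \<le> M" for m n M
    unfolding x_def c_def using kseg_concat_path_mono[of f, OF f that(1-3) B[OF that(2)] that(4)] by (rule sym)
  have le: "n \<le> d (c (B q))" if "n \<in> Nk k" "q \<in> Nk k" "n \<le> q" for n q
    using B[OF that(2)] that c by auto
  have "inf_path k G x"
    unfolding inf_path_def
  proof (intro conjI ballI impI)
    fix m n assume h: "m \<in> Nk k" "n \<in> Nk k" "m \<le> n"
    have x: "x m n = kseg G (c (B n)) m n" "x m m = kseg G (c (B n)) m m"
      "x n n = kseg G (c (B n)) n n"
      using x_eq B_mono h by auto
    show "x m n \<in> \<Lambda>" "d (x m n) = dsub n m" "r (x m n) = x m m" "src (x m n) = x n n"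
      using kseg_closed[of "c (B n)" m n] kseg_vertex[of "c (B n)" m n] h c le[of n n] x by auto
  next
    fix m n q assume h: "m \<in> Nk k" "n \<in> Nk k" "q \<in> Nk k" "m \<le> n" "n \<le> q"
    have x: "x m n = kseg G (c (B q)) m n" "x n q = kseg G (c (B q)) n q"
      "x m q = kseg G (c (B q)) m q"
      using x_eq B_mono h order_trans[of m n q] by auto
    show "x m n \<odot> x n q = x m q"
      using kseg_comp[of "c (B q)" m n q] h c le[of q q] x by auto
  qed
  moreover have "\<exists>l\<in>\<Lambda>. \<exists>N. r l = x m m \<and> src l = src (f N)" if m: "m \<in> Nk k" for m
  proof -
    \<comment> \<open>One block more than needed to reach m: a product of \<open>Suc N\<close>
      blocks ends at the source of the block \<open>f N\<close>, even if N is 0.\<close>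
    define l where "l = c (Suc (B m))"
    have lm: "m \<le> d l"
      using B[OF m] c order_trans[OF B[OF m], of "diag k (Suc (B m))"]
      by (simp add: l_def) (simp add: diag_def le_fun_def)
    have "l \<in> \<Lambda>" using c by (simp add: l_def)
    then obtain a b where ab: "a \<in> \<Lambda>" "b \<in> \<Lambda>" "src a = r b" "d a = m" "l = a \<odot> b"
      using factor[OF _ m lm] by blast
    have "kseg G (a \<odot> r b \<odot> b) m m = r b"
      by (rule kseg_eqI) (use ab in auto)
    moreover have "a \<odot> r b \<odot> b = l" using ab(1,3,5) comp_unit(2)[of a] by simp
    moreover have "x m m = kseg G l m m"
      unfolding l_def by (rule x_eq) (use m in simp_all)
    ultimately have "r b = x m m" by simp
    moreover have "src b = src l" unfolding ab(5) using ab(1-3) by simp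
    moreover have "src l = src (f (B m))"
      using c(3)[of "Suc (B m)"] f(3)[of "B m"] by (simp add: l_def)
    ultimately show ?thesis using ab(2) by metis
  qed
  ultimately show thesis using that by blast
qed

text \<open>By saturation, a vertex outside H emits a path of degree (1,...,1) ending outside H.
  Iterating gives an infinite path whose block ends all avoid H. Cofinality joins w to a vertex of
  this path, heredity puts that vertex and a later block end into H, a contradiction.\<close>

lemma cofinal_hereditary_saturated:
  assumes cof: "cofinal k G" and H: "H \<subseteq> V" "w \<in> H"
    and her: "\<And>l. l \<in> \<Lambda> \<Longrightarrow> r l \<in> H \<Longrightarrow> src l \<in> H"
    and sat: "\<And>v. v \<in> V \<Longrightarrow> src ` kpaths_from G v (diag k 1) \<subseteq> H \<Longrightarrow> v \<in> H"
  shows "H = V"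
proof (rule ccontr)
  assume "H \<noteq> V"
  then obtain v0 where v0: "v0 \<in> V" "v0 \<notin> H" using H by auto
  have ex: "\<exists>l. l \<in> \<Lambda> \<and> r l = v \<and> d l = diag k 1 \<and> src l \<notin> H" if "v \<in> V" "v \<notin> H" for v
    using sat[OF that(1)] that(2) by (auto simp: kpaths_from_def)
  define nxt where "nxt v = (SOME l. l \<in> \<Lambda> \<and> r l = v \<and> d l = diag k 1 \<and> src l \<notin> H)" for v
  have nxt: "nxt v \<in> \<Lambda>" "r (nxt v) = v" "d (nxt v) = diag k 1" "src (nxt v) \<notin> H"
    if "v \<in> V" "v \<notin> H" for v
    using someI_ex[OF ex[OF that]] by (auto simp: nxt_def)
  define u where "u N = ((\<lambda>v. src (nxt v)) ^^ N) v0" for N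
  have u: "u N \<in> V \<and> u N \<notin> H" for N
    by (induction N) (use v0 nxt in \<open>auto simp: u_def\<close>)
  define f where "f N = nxt (u N)" for N
  have f: "f N \<in> \<Lambda>" "d (f N) = diag k 1" "src (f N) = r (f (Suc N))" "src (f N) \<notin> H" for N
    using nxt u[of N] u[of "Suc N"] by (auto simp: f_def u_def)
  obtain x where x: "inf_path k G x"
    "\<And>m. m \<in> Nk k \<Longrightarrow> \<exists>l\<in>\<Lambda>. \<exists>N. r l = x m m \<and> src l = src (f N)"
    using inf_path_exists[of f] f by blast
  have "w \<in> V" using H by auto
  then obtain m l where m: "m \<in> Nk k" "l \<in> \<Lambda>" "r l = w" "src l = x m m"
    using cof x(1) unfolding cofinal_def by blast
  then have "x m m \<in> H" using her[of l] H by simp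
  then show False using x(2)[OF m(1)] her f by metis
qed

end

section \<open>Kumjian-Pask families\<close>

text \<open>The ring carries no one, because the algebra need not have an identity; the module
  structure together with \<open>mult_scale\<close> makes it an R-algebra.\<close>

locale kumjian_pask_family = higher_rank_graph k G + module scale
  for k :: nat and G :: "'a kgraph"
    and scale :: "'r::comm_ring_1 \<Rightarrow> 'b::ring \<Rightarrow> 'b" (infixr "*s" 75) +
  fixes p s t :: "'a \<Rightarrow> 'b"
  assumes row_finite: "row_finite k G"
    and no_sources: "no_sources k G"
    and mult_scale [simp]: "(c *s x) * y = c *s (x * y)" "x * (c *s y) = c *s (x * y)"
    and KP1: "v \<in> kvert G \<Longrightarrow> w \<in> kvert G \<Longrightarrow> p v * p w = (if v = w then p v else 0)"
    and KP2:
      "l \<in> nonzero_paths G \<Longrightarrow> m \<in> nonzero_paths G \<Longrightarrow> krng G m = ksrc G l \<Longrightarrow>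
         s l * s m = s (kcomp G l m)"
      "l \<in> nonzero_paths G \<Longrightarrow> m \<in> nonzero_paths G \<Longrightarrow> krng G m = ksrc G l \<Longrightarrow>
         t m * t l = t (kcomp G l m)"
      "l \<in> nonzero_paths G \<Longrightarrow> p (krng G l) * s l = s l"
      "l \<in> nonzero_paths G \<Longrightarrow> s l * p (ksrc G l) = s l"
      "l \<in> nonzero_paths G \<Longrightarrow> p (ksrc G l) * t l = t l"
      "l \<in> nonzero_paths G \<Longrightarrow> t l * p (krng G l) = t l"
    and KP3: "l \<in> nonzero_paths G \<Longrightarrow> m \<in> nonzero_paths G \<Longrightarrow> kdeg G l = kdeg G m \<Longrightarrow>
         t l * s m = (if l = m then p (ksrc G l) else 0)"
    and KP4: "v \<in> kvert G \<Longrightarrow> n \<in> Nk k \<Longrightarrow> n \<noteq> dzero \<Longrightarrow>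
         p v = (\<Sum>l\<in>kpaths_from G v n. s l * t l)"
begin

text \<open>\<open>S\<close> and \<open>T\<close> treat a vertex as a path of degree zero with s_v =
  p_v, so that factors arising from unique factorization may be vertices without a case
  distinction.\<close>

definition S :: "'a \<Rightarrow> 'b" where "S l = (if l \<in> V then p l else s l)"
definition T :: "'a \<Rightarrow> 'b" where "T l = (if l \<in> V then p l else t l)"

lemma nonzero_pathsI: "l \<in> \<Lambda> \<Longrightarrow> l \<notin> V \<Longrightarrow> l \<in> nonzero_paths G"
  using vertI by (auto simp: nonzero_paths_def)

lemma nonzero_pathsD: "l \<in> nonzero_paths G \<Longrightarrow> l \<in> \<Lambda>" "l \<in> nonzero_paths G \<Longrightarrow> l \<notin> V"
  unfolding nonzero_paths_def using vert_deg by blast+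

lemma S_T_vert [simp]: "v \<in> V \<Longrightarrow> S v = p v" "v \<in> V \<Longrightarrow> T v = p v"
  by (simp_all add: S_def T_def)

lemma p_idem [simp]: "v \<in> V \<Longrightarrow> p v * p v = p v"
  by (simp add: KP1)

lemma p_S_T [simp]:
  assumes "l \<in> \<Lambda>"
  shows "p (r l) * S l = S l" "S l * p (src l) = S l" "p (src l) * T l = T l" "T l * p (r l) = T l"
  using assms KP2(3-6)[of l] nonzero_pathsI[of l] by (cases "l \<in> V"; simp add: S_def T_def)+

lemma p_S_zero:
  assumes "l \<in> \<Lambda>" "v \<in> V" "v \<noteq> r l"
  shows "p v * S l = 0"
proof -
  have "p v * S l = p v * (p (r l) * S l)" using assms by simp
  also have "\<dots> = 0" unfolding mult.assoc[symmetric] using assms by (simp add: KP1)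
  finally show ?thesis .
qed

lemma T_p_zero:
  assumes "l \<in> \<Lambda>" "v \<in> V" "v \<noteq> r l"
  shows "T l * p v = 0"
proof -
  have "T l * p v = T l * p (r l) * p v" using assms by simp
  also have "\<dots> = 0" unfolding mult.assoc using assms by (simp add: KP1)
  finally show ?thesis .
qed

lemma S_S_T_T:
  assumes "l \<in> \<Lambda>" "m \<in> \<Lambda>" "src l = r m"
  shows "S l * S m = S (l \<odot> m)" "T m * T l = T (l \<odot> m)"
proof -
  consider "l \<in> V" | "m \<in> V" | "l \<notin> V" "m \<notin> V" by blast
  then have "S l * S m = S (l \<odot> m) \<and> T m * T l = T (l \<odot> m)"
  proof cases
    case 1
    then have "l = r m" using assms by simp
    then show ?thesis using 1 assms by auto
  next
    case 2
    then have "m = src l" using assms by simp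
    then show ?thesis using 2 assms by auto
  next
    case 3
    then have L: "l \<in> nonzero_paths G" "m \<in> nonzero_paths G" using assms nonzero_pathsI by auto
    then have "d (l \<odot> m) \<noteq> dzero" using assms by (auto simp: nonzero_paths_def)
    then have "l \<odot> m \<notin> V" using vert_deg by blast
    then show ?thesis using L 3 KP2(1,2)[of l m] assms by (simp add: S_def T_def)
  qed
  then show "S l * S m = S (l \<odot> m)" "T m * T l = T (l \<odot> m)" by auto
qed

lemma S_S_zero:
  assumes "l \<in> \<Lambda>" "m \<in> \<Lambda>" "src l \<noteq> r m"
  shows "S l * S m = 0"
proof -
  have "S l * S m = S l * (p (src l) * S m)" using assms by (simp flip: mult.assoc)
  also have "\<dots> = 0" using p_S_zero[of m "src l"] assms by simp
  finally show ?thesis .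
qed

lemma T_S_same_degree:
  assumes "l \<in> \<Lambda>" "m \<in> \<Lambda>" "d l = d m"
  shows "T l * S m = (if l = m then p (src l) else 0)"
proof (cases "l \<in> V")
  case True
  then have "m \<in> V" using assms(3) vert_deg[OF True] by (intro vertI[OF assms(2)]) simp
  then show ?thesis using True by (simp add: KP1)
next
  case False
  then have "m \<notin> V" using assms(3) vert_deg[of m] vertI[OF assms(1)] by auto
  then show ?thesis using False KP3[of l m] assms nonzero_pathsI by (simp add: S_def T_def)
qed

text \<open>Extends (KP4) to degree zero, where the only path with range v is v itself. The
  expansion is thus available in any degree.\<close>

lemma p_eq_sum:
  assumes "v \<in> V" "n \<in> Nk k"
  shows "p v = (\<Sum>l\<in>kpaths_from G v n. S l * T l)"
proof (cases "n = dzero")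
  case True
  have "l = v" if "l \<in> \<Lambda>" "r l = v" "d l = dzero" for l
    using vert_rng_src(1)[OF vertI[OF that(1,3)]] that(2) by simp
  then have "kpaths_from G v n = {v}"
    using assms(1) by (auto simp: True kpaths_from_def)
  then show ?thesis using assms by simp
next
  case False
  have "S l * T l = s l * t l" if "l \<in> kpaths_from G v n" for l
    using that False vert_deg[of l] by (auto simp: S_def T_def kpaths_from_def)
  then show ?thesis using KP4[OF assms False] by simp
qed

lemma T_S_prefix:
  assumes "a \<in> \<Lambda>" "m \<in> \<Lambda>" "src a = r m"
  shows "T a * S (a \<odot> m) = S m" "T (a \<odot> m) * S a = T m"
proof -
  have "T a * S (a \<odot> m) = T a * S a * S m"
    using S_S_T_T[OF assms] by (simp add: mult.assoc)
  then show "T a * S (a \<odot> m) = S m" using assms T_S_same_degree[of a a] by simp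
  have "T (a \<odot> m) * S a = T m * (T a * S a)"
    using S_S_T_T[OF assms] by (simp flip: mult.assoc)
  then show "T (a \<odot> m) * S a = T m" using assms T_S_same_degree[of a a] by simp
qed

lemma T_S_prefix_zero:
  assumes "a \<in> \<Lambda>" "m \<in> \<Lambda>" "src a = r m" "b \<in> \<Lambda>" "d b = d a" "b \<noteq> a"
  shows "T b * S (a \<odot> m) = 0" "T (a \<odot> m) * S b = 0"
proof -
  have "T b * S (a \<odot> m) = T b * S a * S m"
    using S_S_T_T[OF assms(1-3)] by (simp add: mult.assoc)
  then show "T b * S (a \<odot> m) = 0" using assms T_S_same_degree[of b a] by simp
  have "T (a \<odot> m) * S b = T m * (T a * S b)"
    using S_S_T_T[OF assms(1-3)] by (simp flip: mult.assoc)
  then show "T (a \<odot> m) * S b = 0" using assms T_S_same_degree[of a b] by simp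
qed

text \<open>Write \<tau> as b followed by m with b of the degree of a. By (KP3) the products vanish
  unless b equals a, in which case a cancels and m remains.\<close>

lemma T_S_le_cases:
  assumes "a \<in> \<Lambda>" "\<tau> \<in> \<Lambda>" "d a \<le> d \<tau>"
  obtains (prefix) m where "m \<in> \<Lambda>" "src a = r m" "\<tau> = a \<odot> m" "T a * S \<tau> = S m" "T \<tau> * S a = T m"
  | (zero) "T a * S \<tau> = 0" "T \<tau> * S a = 0"
proof -
  obtain b m where bm: "b \<in> \<Lambda>" "m \<in> \<Lambda>" "src b = r m" "d b = d a" "\<tau> = b \<odot> m"
    using factor[OF assms(2) deg_Nk[OF assms(1)] assms(3)] by blast
  show thesis
  proof (cases "a = b")
    case True
    then show thesis using prefix[of m] T_S_prefix[of b m] bm by simp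
  next
    case False
    then show thesis using zero T_S_prefix_zero[of b m a] bm assms by simp
  qed
qed

lemma T_S_expand:
  assumes "a \<in> \<Lambda>" "b \<in> \<Lambda>" "q \<in> Nk k"
  shows "T a * S b = (\<Sum>\<tau>\<in>kpaths_from G (r b) q. (T a * S \<tau>) * (T \<tau> * S b))"
proof -
  have "T a * S b = T a * (p (r b) * S b)" using assms by simp
  also have "\<dots> = (\<Sum>\<tau>\<in>kpaths_from G (r b) q. T a * (S \<tau> * T \<tau> * S b))"
    using p_eq_sum[of "r b" q] assms by (simp add: sum_distrib_left sum_distrib_right)
  finally show ?thesis by (simp add: mult.assoc)
qed

lemma T_S_zero:
  assumes "a \<in> \<Lambda>" "b \<in> \<Lambda>"
    and no_ext: "\<And>x y. x \<in> \<Lambda> \<Longrightarrow> y \<in> \<Lambda> \<Longrightarrow> src a = r x \<Longrightarrow> src b = r y \<Longrightarrow> a \<odot> x \<noteq> b \<odot> y"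
  shows "T a * S b = 0"
proof -
  \<comment> \<open>The least degree at which a path can be compared with both a and b by
    \<open>T_S_le_cases\<close>. A nonzero term would make \<tau> a common extension of a and
    b.\<close>
  let ?q = "sup (d a) (d b)"
  have "(T a * S \<tau>) * (T \<tau> * S b) = 0" if "\<tau> \<in> kpaths_from G (r b) ?q" for \<tau>
  proof -
    have \<tau>: "\<tau> \<in> \<Lambda>" "d a \<le> d \<tau>" "d b \<le> d \<tau>" using that by (auto simp: kpaths_from_def)
    from assms(1) \<tau>(1,2) show ?thesis
    proof (cases rule: T_S_le_cases)
      case (prefix x)
      note px = prefix
      from assms(2) \<tau>(1,3) show ?thesis
      proof (cases rule: T_S_le_cases)
        case (prefix y)
        then show ?thesis using no_ext[of x y] px by metis
      qed simp
    qed simp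
  qed
  then show ?thesis using T_S_expand[of a b ?q] assms by simp
qed

section \<open>Normal forms span, and their span has local units\<close>

definition normal_forms :: "'b set" where
  "normal_forms = {S a * T b | a b. a \<in> \<Lambda> \<and> b \<in> \<Lambda> \<and> src a = src b}"

lemma normal_formsI: "a \<in> \<Lambda> \<Longrightarrow> b \<in> \<Lambda> \<Longrightarrow> src a = src b \<Longrightarrow> S a * T b \<in> span normal_forms"
  by (auto simp: normal_forms_def intro!: span_base)

lemma generators_in_span:
  assumes "l \<in> \<Lambda>"
  shows "S l \<in> span normal_forms" "T l \<in> span normal_forms"
  using normal_formsI[of l "src l"] normal_formsI[of "src l" l] assms by simp_all

text \<open>This is the reordering step: in the expansion of \<open>T a * S b\<close> the terms that
  survive are \<open>S x * T y\<close>, where \<tau> extends a by x and b by y, and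
  \<open>T y\<close> is absorbed into \<open>T e\<close> as \<open>T (e \<odot> y)\<close>.\<close>

lemma T_S_in_span:
  assumes "a \<in> \<Lambda>" "b \<in> \<Lambda>" "e \<in> \<Lambda>" "src b = src e"
  shows "T a * (S b * T e) \<in> span normal_forms"
proof -
  let ?q = "sup (d a) (d b)"
  have "(T a * S \<tau>) * (T \<tau> * S b) * T e \<in> span normal_forms" if "\<tau> \<in> kpaths_from G (r b) ?q" for \<tau>
  proof -
    have \<tau>: "\<tau> \<in> \<Lambda>" "d a \<le> d \<tau>" "d b \<le> d \<tau>" using that by (auto simp: kpaths_from_def)
    from assms(1) \<tau>(1,2) show ?thesis
    proof (cases rule: T_S_le_cases)
      case (prefix x)
      note px = prefix
      from assms(2) \<tau>(1,3) show ?thesis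
      proof (cases rule: T_S_le_cases)
        case (prefix y)
        have sx: "src x = src \<tau>" unfolding px(3) using px(1,2) assms(1) by simp
        have sy: "src y = src \<tau>" unfolding prefix(3) using prefix(1,2) assms(2) by simp
        have ey: "src e = r y" using assms(4) prefix(2) by simp
        have xy: "src x = src (e \<odot> y)" "e \<odot> y \<in> \<Lambda>"
          using ey sx sy prefix(1) assms(3) by simp_all
        have "T y * T e = T (e \<odot> y)" using S_S_T_T(2)[OF assms(3) prefix(1) ey] .
        then have "S x * T y * T e = S x * T (e \<odot> y)" by (simp only: mult.assoc)
        then show ?thesis
          using normal_formsI[OF px(1) xy(2,1)] unfolding px(4) prefix(5) by simp
      qed (simp add: span_zero)
    qed (simp add: span_zero)
  qed
  then show ?thesis
    unfolding mult.assoc[symmetric] T_S_expand[OF assms(1,2) Nk_closed(4)[OF deg_Nk[OF assms(1)] deg_Nk[OF assms(2)]]]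
    by (simp add: sum_distrib_right span_sum)
qed

text \<open>Stability under left multiplication by generators is exactly what an induction over
  words, adding letters on the left, asks for.\<close>

lemma generator_mult_span:
  assumes "l \<in> \<Lambda>" "x \<in> span normal_forms"
  shows "S l * x \<in> span normal_forms" "T l * x \<in> span normal_forms"
proof -
  have "S l * x \<in> span normal_forms \<and> T l * x \<in> span normal_forms"
    using assms(2)
  proof (induction x rule: span_induct_alt)
    case base
    then show ?case by (simp add: span_zero)
  next
    case (step c x y)
    then obtain a b where ab: "x = S a * T b" "a \<in> \<Lambda>" "b \<in> \<Lambda>" "src a = src b"
      by (auto simp: normal_forms_def)
    have "S l * x \<in> span normal_forms"
    proof (cases "src l = r a")
      case True
      then have "S l * x = S (l \<odot> a) * T b"
        using S_S_T_T(1)[of l a] assms(1) ab by (simp flip: mult.assoc)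
      then show ?thesis using normal_formsI[of "l \<odot> a" b] True assms(1) ab by simp
    next
      case False
      then show ?thesis using S_S_zero[of l a] assms(1) ab by (simp add: span_zero flip: mult.assoc)
    qed
    moreover have "T l * x \<in> span normal_forms"
      using T_S_in_span ab assms(1) by simp
    ultimately show ?case
      using step by (simp add: distrib_left span_add span_scale)
  qed
  then show "S l * x \<in> span normal_forms" "T l * x \<in> span normal_forms" by auto
qed

text \<open>A normal form \<open>S a * T b\<close> is fixed by every sum of vertex idempotents that
  includes \<open>r a\<close> on the left and \<open>r b\<close> on the right. Quantifying over all
  larger finite sets lets the sets of different summands be merged in the induction.\<close>

lemma span_local_unit:
  assumes "x \<in> span normal_forms"
  obtains F where "finite F" "F \<subseteq> V"
    "\<And>F'. finite F' \<Longrightarrow> F \<subseteq> F' \<Longrightarrow> F' \<subseteq> V \<Longrightarrow> x * sum p F' = x \<and> sum p F' * x = x"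
proof -
  have "\<exists>F. finite F \<and> F \<subseteq> V \<and>
      (\<forall>F'. finite F' \<longrightarrow> F \<subseteq> F' \<longrightarrow> F' \<subseteq> V \<longrightarrow> x * sum p F' = x \<and> sum p F' * x = x)"
    using assms
  proof (induction x rule: span_induct_alt)
    case base
    then show ?case by (intro exI[of _ "{}"]) simp
  next
    case (step c x y)
    obtain F where F: "finite F" "F \<subseteq> V"
      "\<And>F'. finite F' \<Longrightarrow> F \<subseteq> F' \<Longrightarrow> F' \<subseteq> V \<Longrightarrow> y * sum p F' = y \<and> sum p F' * y = y"
      using step.IH by blast
    obtain a b where ab: "x = S a * T b" "a \<in> \<Lambda>" "b \<in> \<Lambda>"
      using step by (auto simp: normal_forms_def)
    have x: "x * sum p F' = x \<and> sum p F' * x = x"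
      if "finite F'" "{r a, r b} \<subseteq> F'" "F' \<subseteq> V" for F'
    proof -
      have "T b * sum p F' = (\<Sum>v\<in>F'. if v = r b then T b else 0)"
        unfolding sum_distrib_left
        by (rule sum.cong) (use T_p_zero[of b] that ab in auto)
      moreover have "sum p F' * S a = (\<Sum>v\<in>F'. if v = r a then S a else 0)"
        unfolding sum_distrib_right
        by (rule sum.cong) (use p_S_zero[of a] that ab in auto)
      ultimately have "T b * sum p F' = T b" "sum p F' * S a = S a"
        using that by simp_all
      then show ?thesis
        unfolding ab(1) by (simp add: mult.assoc) (simp flip: mult.assoc)
    qed
    show ?case
      by (rule exI[of _ "insert (r a) (insert (r b) F)"])
        (use F x ab in \<open>auto simp: distrib_left distrib_right\<close>)
  qed
  then show thesis using that by blast
qed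

section \<open>Central elements and the scalars by which they act on vertices\<close>

definition central :: "'b \<Rightarrow> bool" where
  "central a \<longleftrightarrow> (\<forall>l\<in>\<Lambda>. a * S l = S l * a \<and> a * T l = T l * a)"

text \<open>The vertices where the central element a acts as c are shown to be hereditary by (KP3)
  and saturated by (KP4); cofinality then makes them all of \<open>V\<close>.\<close>

lemma central_scalar_on_vertices:
  assumes cof: "cofinal k G" and a: "central a"
    and w: "w \<in> V" "a * p w = c *s p w" and v: "v \<in> V"
  shows "a * p v = c *s p v"
proof -
  define H where "H = {v \<in> V. a * p v = c *s p v}"
  have "H = V"
  proof (rule cofinal_hereditary_saturated[OF cof])
    show "H \<subseteq> V" "w \<in> H" using w by (auto simp: H_def)
  next
    fix l assume l: "l \<in> \<Lambda>" "r l \<in> H"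
    have TS: "T l * S l = p (src l)" using T_S_same_degree[of l l] l by simp
    \<comment> \<open>Writing \<open>p (src l)\<close> as \<open>T l * S l\<close> lets centrality
      carry a over to \<open>p (r l)\<close>, where the scalar is known.\<close>
    have "a * p (src l) = (T l * p (r l)) * a * S l"
      using a l unfolding TS[symmetric] central_def by (metis mult.assoc p_S_T(4))
    also have "\<dots> = T l * (a * p (r l)) * S l"
      using a S_T_vert(1)[of "r l"] l rng_src_vert(1)[of l] unfolding central_def
      by (metis mult.assoc vert_mor)
    also have "\<dots> = T l * (c *s p (r l)) * S l" using l by (simp add: H_def)
    also have "\<dots> = c *s p (src l)" using l TS by simp
    finally show "src l \<in> H" using l by (simp add: H_def)
  next
    fix v assume v: "v \<in> V" "src ` kpaths_from G v (diag k 1) \<subseteq> H"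
    have "a * (S l * T l) = c *s (S l * T l)" if "l \<in> kpaths_from G v (diag k 1)" for l
    proof -
      have l: "l \<in> \<Lambda>" "a * p (src l) = c *s p (src l)"
        using that v by (auto simp: kpaths_from_def H_def)
      \<comment> \<open>Here a is carried past \<open>S l\<close> to \<open>p (src l)\<close>;
        summing over l yields \<open>p v\<close>.\<close>
      have "a * (S l * T l) = S l * (a * p (src l)) * T l"
        using a l(1) unfolding central_def by (metis mult.assoc p_S_T(3))
      also have "\<dots> = c *s (S l * T l)" using l by simp
      finally show ?thesis .
    qed
    then show "v \<in> H"
      using v p_eq_sum[of v "diag k 1"]
      by (simp add: H_def sum_distrib_left scale_sum_right)
  qed
  then show ?thesis using v by (auto simp: H_def)
qed

theorem central_zero:
  assumes "cofinal k G" "infinite V" "central a" "a \<in> span normal_forms"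
  shows "a = 0"
proof -
  obtain F where F: "finite F" "F \<subseteq> V" "a * sum p F = a"
    using span_local_unit[OF assms(4)] by (metis order_refl)
  obtain w where w: "w \<in> V" "w \<notin> F"
    using assms(2) F(1) by (meson finite_subset subsetI)
  have "sum p F * p w = (\<Sum>v\<in>F. 0)"
    unfolding sum_distrib_right
    by (rule sum.cong) (use F w in \<open>auto simp: KP1\<close>)
  \<comment> \<open>The vertex w lies outside the support of the local unit of a, so a acts there as
    the scalar 0, which then spreads to every vertex.\<close>
  then have "a * p w = 0 *s p w"
    using F(3) by (metis mult.assoc mult_zero_right scale_zero_left sum.neutral_const)
  then have "a * p v = 0" if "v \<in> V" for v
    using central_scalar_on_vertices[OF assms(1,3) w(1) _ that, of 0] by simp
  then have "a * sum p F = 0" using F(2) by (auto simp: sum_distrib_left intro!: sum.neutral)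
  then show ?thesis using F(3) by simp
qed

section \<open>Aperiodicity and compression to a vertex\<close>

lemma long_path:
  assumes "v \<in> V" "n \<in> Nk k"
  obtains l where "l \<in> \<Lambda>" "r l = v" "d l = n"
  using no_sources assms by (auto simp: no_sources_def kpaths_from_def)

text \<open>A common extension of the two prolonged paths would have a single segment starting at
  the join of their original degrees. Read in the two copies of l, it is a segment of l at m and one
  at n, and aperiodicity chooses l so that these differ.\<close>

lemma aperiodic_no_common_extension:
  assumes ap: "aperiodic k G" and \<mu>\<nu>: "\<mu> \<in> \<Lambda>" "\<nu> \<in> \<Lambda>" "src \<mu> = src \<nu>" "d \<mu> \<noteq> d \<nu>"
  obtains l where "l \<in> \<Lambda>" "r l = src \<mu>" "T (\<mu> \<odot> l) * S (\<nu> \<odot> l) = 0"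
proof -
  let ?q = "sup (d \<mu>) (d \<nu>)"
  \<comment> \<open>The offsets by which each of the two degrees falls short of the join; they
    differ because the degrees do.\<close>
  define m n where "m = dsub ?q (d \<mu>)" and "n = dsub ?q (d \<nu>)"
  have qm: "dadd (d \<mu>) m = ?q" and qn: "dadd (d \<nu>) n = ?q" by (simp_all add: m_def n_def)
  have mn: "m \<in> Nk k" "n \<in> Nk k" using \<mu>\<nu> by (simp_all add: m_def n_def)
  have "m \<noteq> n"
  proof
    assume "m = n"
    then have "dadd n (d \<mu>) = dadd n (d \<nu>)" using qm qn by (simp add: dadd_def add.commute)
    then show False using \<mu>\<nu>(4) by simp
  qed
  then obtain l where l: "l \<in> \<Lambda>" "r l = src \<mu>" "sup m n \<le> d l"
      and ne: "kseg G l m (dadd m (dsub (d l) (sup m n))) \<noteq> kseg G l n (dadd n (dsub (d l) (sup m n)))"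
    using ap mn rng_src_vert(2)[OF \<mu>\<nu>(1)] unfolding aperiodic_def by blast
  define e where "e = dsub (d l) (sup m n)"
  have e: "e \<in> Nk k" using l by (simp add: e_def)
  have "m i + (d l i - sup (m i) (n i)) \<le> d l i" "n i + (d l i - sup (m i) (n i)) \<le> d l i" for i
    using le_funD[OF l(3), of i] by (auto simp: sup_nat_def)
  then have me: "dadd m e \<le> d l" "dadd n e \<le> d l"
    by (auto simp: e_def dadd_def dsub_def le_fun_def)
  have "T (\<mu> \<odot> l) * S (\<nu> \<odot> l) = 0"
  proof (rule T_S_zero)
    show "\<mu> \<odot> l \<in> \<Lambda>" "\<nu> \<odot> l \<in> \<Lambda>" using \<mu>\<nu> l by simp_all
  next
    fix x y assume xy: "x \<in> \<Lambda>" "y \<in> \<Lambda>" "src (\<mu> \<odot> l) = r x" "src (\<nu> \<odot> l) = r y"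
    have sl: "src l = r x" "src l = r y" using xy \<mu>\<nu> l by simp_all
    \<comment> \<open>By \<open>me\<close> the window of degree e starting at \<open>?q\<close> lies
      inside the copy of l, so x has no influence on it.\<close>
    have "kseg G (\<mu> \<odot> l \<odot> x) ?q (dadd ?q e) = kseg G l m (dadd m e)"
      using kseg_inner[of \<mu> l x m "dadd m e"] \<mu>\<nu> l xy(1) sl mn e me
      by (simp add: qm flip: dadd_assoc)
    moreover have "kseg G (\<nu> \<odot> l \<odot> y) ?q (dadd ?q e) = kseg G l n (dadd n e)"
      using kseg_inner[of \<nu> l y n "dadd n e"] \<mu>\<nu> l xy(2) sl mn e me
      by (simp add: qn flip: dadd_assoc)
    ultimately show "\<mu> \<odot> l \<odot> x \<noteq> \<nu> \<odot> l \<odot> y" using ne unfolding e_def by metis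
  qed
  then show thesis using that l by blast
qed

text \<open>The path l is arbitrary, and m only prolongs it, so that further summands can be
  compressed along the result.\<close>

lemma compress_normal_form:
  assumes ap: "aperiodic k G" and ab: "a \<in> \<Lambda>" "b \<in> \<Lambda>" "src a = src b" and l: "l \<in> \<Lambda>"
  obtains m c where "m \<in> \<Lambda>" "r m = src l"
    "T (l \<odot> m) * (S a * T b) * S (l \<odot> m) = c *s p (src m)"
proof -
  note witness = that
  \<comment> \<open>This degree makes \<open>l1\<close> at least as long as both a and b, so that
    each can be compared with it as a prefix.\<close>
  obtain m0 where m0: "m0 \<in> \<Lambda>" "r m0 = src l" "d m0 = sup (d a) (d b)"
    using long_path[of "src l" "sup (d a) (d b)"] l ab by auto
  define l1 where "l1 = l \<odot> m0"
  have l1: "l1 \<in> \<Lambda>" "src l1 = src m0" "r l1 = r l" using l m0 by (simp_all add: l1_def)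
  have "d m0 \<le> d l1" using l m0 by (simp add: l1_def)
  then have le: "d a \<le> d l1" "d b \<le> d l1" using m0(3) by auto
  have reassoc: "T l1 * (S a * T b) * S l1 = (T l1 * S a) * (T b * S l1)" by (simp add: mult.assoc)
  have zero_case: thesis if "T l1 * (S a * T b) * S l1 = 0"
    using that m0 by (intro witness[of m0 0]) (simp_all flip: l1_def)
  show thesis
    using ab(1) l1(1) le(1)
  proof (cases rule: T_S_le_cases)
    case zero
    then show thesis using zero_case reassoc by simp
  next
    case (prefix \<mu>)
    note \<mu> = prefix
    show thesis
      using ab(2) l1(1) le(2)
    proof (cases rule: T_S_le_cases)
      case zero
      then show thesis using zero_case reassoc by simp
    next
      case (prefix \<nu>)
      note \<nu> = prefix
      have red: "T l1 * (S a * T b) * S l1 = T \<mu> * S \<nu>" using reassoc \<mu> \<nu> by simp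
      have src: "src \<mu> = src l1" "src \<nu> = src l1"
        using \<mu>(1-3) \<nu>(1-3) ab comp_closed(3) by metis+
      show thesis
      proof (cases "d \<mu> = d \<nu>")
        case True
        \<comment> \<open>Both products equal \<open>l1\<close>; once the tails have equal degrees,
          unique factorization makes them equal, and (KP3) gives the scalar 1.\<close>
        have "dadd (d a) (d \<mu>) = dadd (d b) (d \<nu>)"
          using \<mu>(1-3) \<nu>(1-3) ab comp_closed(4) by metis
        then have "d a = d b" using True by (auto simp: dadd_def fun_eq_iff)
        then have "\<mu> = \<nu>"
          using factor_unique(2)[of a \<mu> b \<nu>] \<mu>(1-3) \<nu>(1-3) ab by metis
        then have "T l1 * (S a * T b) * S l1 = 1 *s p (src m0)"
          using red T_S_same_degree[of \<nu> \<nu>] \<nu>(1) src l1 by simp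
        then show thesis using m0 by (intro witness[of m0 1]) (simp_all flip: l1_def)
      next
        case False
        obtain l2 where l2: "l2 \<in> \<Lambda>" "r l2 = src \<mu>" "T (\<mu> \<odot> l2) * S (\<nu> \<odot> l2) = 0"
          using aperiodic_no_common_extension[OF ap \<mu>(1) \<nu>(1) _ False] src by metis
        have m: "m0 \<odot> l2 \<in> \<Lambda>" "r (m0 \<odot> l2) = src l" "l \<odot> (m0 \<odot> l2) = l1 \<odot> l2"
          using m0 l l2(1,2) src l1 comp_assoc[of l m0 l2] by (simp_all add: l1_def)
        have "T (l1 \<odot> l2) = T l2 * T l1" "S (l1 \<odot> l2) = S l1 * S l2"
          using S_S_T_T[of l1 l2] l1 l2(1,2) src by simp_all
        then have "T (l1 \<odot> l2) * (S a * T b) * S (l1 \<odot> l2) = T l2 * (T l1 * (S a * T b) * S l1) * S l2"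
          by (simp add: mult.assoc)
        also have "\<dots> = (T l2 * T \<mu>) * (S \<nu> * S l2)" unfolding red by (simp add: mult.assoc)
        also have "\<dots> = 0"
          using S_S_T_T[of \<mu> l2] S_S_T_T[of \<nu> l2] \<mu>(1) \<nu>(1) l2 src by simp
        finally show thesis using m by (intro witness[of "m0 \<odot> l2" 0]) simp_all
      qed
    qed
  qed
qed

text \<open>Induction over the summands: first prolong l by m to compress y, then by n to compress
  the new normal form. The result for y survives because
  \<open>T n * p (r n) * S n = p (src n)\<close>, and the two scalars combine to
  \<open>c * c2 + c1\<close>.\<close>

lemma compress:
  assumes ap: "aperiodic k G" and x: "x \<in> span normal_forms" and l: "l \<in> \<Lambda>"
  shows "\<exists>m\<in>\<Lambda>. r m = src l \<and> (\<exists>c. T (l \<odot> m) * x * S (l \<odot> m) = c *s p (src m))"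
  using x l
proof (induction x arbitrary: l rule: span_induct_alt)
  case base
  then show ?case by (intro bexI[of _ "src l"] conjI exI[of _ 0]) simp_all
next
  case (step c x y)
  obtain a b where ab: "x = S a * T b" "a \<in> \<Lambda>" "b \<in> \<Lambda>" "src a = src b"
    using step by (auto simp: normal_forms_def)
  obtain m c1 where m: "m \<in> \<Lambda>" "r m = src l" "T (l \<odot> m) * y * S (l \<odot> m) = c1 *s p (src m)"
    using step.IH[OF step.prems] by blast
  define l1 where "l1 = l \<odot> m"
  have l1: "l1 \<in> \<Lambda>" "src l1 = src m" using m step.prems by (simp_all add: l1_def)
  obtain n c2 where n: "n \<in> \<Lambda>" "r n = src l1" "T (l1 \<odot> n) * x * S (l1 \<odot> n) = c2 *s p (src n)"
    using compress_normal_form[OF ap ab(2-4) l1(1)] unfolding ab(1) by metis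
  have mn: "m \<odot> n \<in> \<Lambda>" "r (m \<odot> n) = src l" "src (m \<odot> n) = src n" "l \<odot> (m \<odot> n) = l1 \<odot> n"
    using m n(1,2) l1 step.prems comp_assoc[of l m n] by (simp_all add: l1_def)
  have "T (l1 \<odot> n) = T n * T l1" "S (l1 \<odot> n) = S l1 * S n"
    using S_S_T_T[of l1 n] l1 n(1,2) by simp_all
  then have "T (l1 \<odot> n) * y * S (l1 \<odot> n) = T n * (T l1 * y * S l1) * S n"
    by (simp add: mult.assoc)
  also have "\<dots> = T n * (c1 *s p (r n)) * S n" using m(3) n(2) l1 by (simp flip: l1_def)
  also have "\<dots> = c1 *s p (src n)" using n(1) T_S_same_degree[of n n] by simp
  finally have "T (l1 \<odot> n) * (c *s x + y) * S (l1 \<odot> n) = (c * c2 + c1) *s p (src n)"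
    using n(3) by (simp add: distrib_left distrib_right scale_left_distrib)
  then show ?case using mn by metis
qed

theorem central_scalar:
  assumes "aperiodic k G" "cofinal k G" "finite V" "central a" "a \<in> span normal_forms"
  shows "\<exists>c. a = c *s sum p V"
proof -
  have a: "a = a * sum p V"
    using span_local_unit[OF assms(5)] assms(3) by (metis order_refl)
  show ?thesis
  proof (cases "V = {}")
    \<comment> \<open>Without vertices \<open>sum p V\<close> is 0, and being a unit for a it forces
      a to be 0.\<close>
    case True
    then show ?thesis using a by simp
  next
    case False
    then obtain v where v: "v \<in> V" by blast
    \<comment> \<open>Compression starts from the trivial path at v, so the compressing path is m
      itself.\<close>
    obtain m c where m: "m \<in> \<Lambda>" "r m = v" "T (v \<odot> m) * a * S (v \<odot> m) = c *s p (src m)"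
      using compress[OF assms(1,5) vert_mor[OF v]] v by auto
    have "v \<odot> m = m" using m(1,2) comp_unit(1) by metis
    then have "T m * a * S m = c *s p (src m)" using m(3) by simp
    moreover have "T m * a * S m = a * p (src m)"
      using assms(4) m(1) T_S_same_degree[of m m] unfolding central_def by (metis mult.assoc)
    ultimately have "a * p w = c *s p w" if "w \<in> V" for w
      using central_scalar_on_vertices[OF assms(2,4) rng_src_vert(2)[OF m(1)] _ that] by simp
    then have "a * sum p V = c *s sum p V"
      by (simp add: sum_distrib_left scale_sum_right)
    then show ?thesis using a by metis
  qed
qed

end

section \<open>The presented algebra as a ring\<close>

lemma fa_mult_Nil: "fa_mult f g [] = f [] * g []"
  by (simp add: fa_mult_def)

lemma fa_mult_Cons: "fa_mult f g (x # w) = f [] * g (x # w) + fa_mult (\<lambda>u. f (x # u)) g w"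
  by (simp add: fa_mult_def sum.atMost_Suc_shift del: sum.atMost_Suc)

lemma fa_mult_add:
  "fa_mult (fa_add f g) h = fa_add (fa_mult f h) (fa_mult g h)"
  "fa_mult f (fa_add g h) = fa_add (fa_mult f g) (fa_mult f h)"
  by (simp_all add: fa_mult_def fa_add_def algebra_simps sum.distrib)

lemma fa_add_group:
  "fa_add (fa_add a b) c = fa_add a (fa_add b c)"
  "fa_add b a = fa_add a b"
  "fa_add fa_zero a = a"
  "fa_add (fa_smult (- 1) a) a = fa_zero"
  by (simp_all add: fa_add_def fa_zero_def fa_smult_def add_ac)

lemma fa_mult_smult:
  "fa_mult (fa_smult c f) g = fa_smult c (fa_mult f g)"
  "fa_mult f (fa_smult c g) = fa_smult c (fa_mult f g)"
  by (simp_all add: fa_mult_def fa_smult_def sum_distrib_left mult_ac)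

text \<open>Induction on the word through left derivatives \<open>\<lambda>u. f (x # u)\<close>. The
  derivative of a product is \<open>f []\<close> times the derivative of g plus the product of the
  derivative of f with g, hence f and g must vary.\<close>

lemma fa_mult_assoc: "fa_mult (fa_mult f g) h = fa_mult f (fa_mult g h)"
proof
  fix w show "fa_mult (fa_mult f g) h w = fa_mult f (fa_mult g h) w"
  proof (induction w arbitrary: f g)
    case Nil
    show ?case by (simp add: fa_mult_Nil mult.assoc)
  next
    case (Cons x w)
    have "(\<lambda>u. fa_mult f g (x # u)) =
        fa_add (fa_smult (f []) (\<lambda>u. g (x # u))) (fa_mult (\<lambda>u. f (x # u)) g)"
      by (simp add: fa_mult_Cons fa_add_def fa_smult_def)
    then have "fa_mult (fa_mult f g) h (x # w) = f [] * g [] * h (x # w) +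
        (f [] * fa_mult (\<lambda>u. g (x # u)) h w + fa_mult (fa_mult (\<lambda>u. f (x # u)) g) h w)"
      by (simp add: fa_mult_Cons[of "fa_mult f g"] fa_mult_Nil fa_mult_add fa_mult_smult)
        (simp add: fa_add_def fa_smult_def)
    then show ?case
      by (simp add: Cons.IH fa_mult_Cons[of f] fa_mult_Cons[of g] algebra_simps)
  qed
qed

lemma fa_smult_module:
  "fa_smult c (fa_add a b) = fa_add (fa_smult c a) (fa_smult c b)"
  "fa_smult (c + e) a = fa_add (fa_smult c a) (fa_smult e a)"
  "fa_smult c (fa_smult e a) = fa_smult (c * e) a"
  "fa_smult 1 a = a"
  by (simp_all add: fa_smult_def fa_add_def algebra_simps)

lemma fa_smult_zero: "fa_smult c fa_zero = fa_zero"
  by (simp add: fa_smult_def fa_zero_def)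

lemma fa_mult_zero: "fa_mult fa_zero a = fa_zero" "fa_mult a fa_zero = fa_zero"
  by (simp_all add: fa_mult_def fa_zero_def)

lemma fa_carrier_closed [simp]:
  "fa_zero \<in> fa_carrier"
  "a \<in> fa_carrier \<Longrightarrow> b \<in> fa_carrier \<Longrightarrow> fa_add a b \<in> fa_carrier"
  "a \<in> fa_carrier \<Longrightarrow> b \<in> fa_carrier \<Longrightarrow> fa_minus a b \<in> fa_carrier"
  "a \<in> fa_carrier \<Longrightarrow> fa_smult c a \<in> fa_carrier"
  "fa_gen g \<in> fa_carrier"
proof -
  assume a: "a \<in> fa_carrier"
  show "fa_smult c a \<in> fa_carrier"
    using a by (auto simp: fa_carrier_def fa_smult_def elim!: rev_finite_subset)
next
  assume a: "a \<in> fa_carrier" and b: "b \<in> fa_carrier"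
  have *: "finite ({w. a w \<noteq> 0} \<union> {w. b w \<noteq> 0})" using a b by (simp add: fa_carrier_def)
  show "fa_add a b \<in> fa_carrier" "fa_minus a b \<in> fa_carrier"
    using a b by (auto simp: fa_carrier_def fa_add_def fa_minus_def intro: finite_subset[OF _ *])
qed (auto simp: fa_carrier_def fa_zero_def fa_gen_def)

lemma fa_mult_carrier [simp]:
  assumes "a \<in> fa_carrier" "b \<in> fa_carrier"
  shows "fa_mult a b \<in> fa_carrier"
proof -
  let ?A = "{w. a w \<noteq> 0}" and ?B = "{w. b w \<noteq> 0}"
  have "w \<in> (\<lambda>(u, v). u @ v) ` (?A \<times> ?B)" if w: "fa_mult a b w \<noteq> 0" for w
  proof -
    obtain i where "a (take i w) * b (drop i w) \<noteq> 0"
      using w unfolding fa_mult_def by (meson sum.not_neutral_contains_not_neutral)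
    then have "(take i w, drop i w) \<in> ?A \<times> ?B" by auto
    then show ?thesis by (rule rev_image_eqI) simp
  qed
  then have "{w. fa_mult a b w \<noteq> 0} \<subseteq> (\<lambda>(u, v). u @ v) ` (?A \<times> ?B)" by blast
  moreover have "finite (?A \<times> ?B)" using assms by (simp add: fa_carrier_def)
  ultimately have "finite {w. fa_mult a b w \<noteq> 0}" using finite_subset by blast
  then show ?thesis using assms by (simp add: fa_carrier_def fa_mult_Nil)
qed

section \<open>Finite sums, words, and induction over the free algebra\<close>

lemma fa_sum_insert:
  "finite A \<Longrightarrow> x \<notin> A \<Longrightarrow> fa_sum F (insert x A) = fa_add (F x) (fa_sum F A)"
  by (simp add: fa_sum_def fa_add_def)

lemma fa_sum_empty: "fa_sum F {} = fa_zero"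
  by (simp add: fa_sum_def fa_zero_def)

lemma fa_sum_carrier:
  assumes "finite A" "\<And>x. x \<in> A \<Longrightarrow> F x \<in> fa_carrier"
  shows "fa_sum F A \<in> fa_carrier"
  using assms by (induction A) (simp_all add: fa_sum_empty fa_sum_insert)

definition fa_word :: "'g list \<Rightarrow> ('g, 'r::comm_ring_1) fa" where
  "fa_word u = (\<lambda>w. if w = u then 1 else 0)"

lemma fa_mult_gen_Cons: "fa_mult (fa_gen g) f (x # v) = (if x = g then f v else 0)"
proof -
  have "fa_gen g (take i (x # v)) * f (drop i (x # v)) =
      (if i = Suc 0 then if x = g then f v else 0 else 0)" if "i \<le> length (x # v)" for i
    using that by (cases i) (auto simp: fa_gen_def)
  then have "fa_mult (fa_gen g) f (x # v) =
      (\<Sum>i\<le>length (x # v). if i = Suc 0 then if x = g then f v else 0 else 0)"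
    unfolding fa_mult_def by (intro sum.cong) auto
  then show ?thesis by (simp del: sum.atMost_Suc)
qed

lemma fa_word_Cons: "fa_word (g # u) = fa_mult (fa_gen g) (fa_word u)"
proof
  fix w show "fa_word (g # u) w = fa_mult (fa_gen g) (fa_word u) w"
  proof (cases w)
    case Nil
    then show ?thesis by (simp add: fa_mult_Nil fa_word_def fa_gen_def)
  next
    case (Cons x v)
    then show ?thesis unfolding Cons fa_mult_gen_Cons by (simp add: fa_word_def)
  qed
qed

text \<open>Every element is a finite combination of nonempty words, and a nonempty word arises from
  its last letter by multiplying with generators on the left.\<close>

lemma fa_carrier_induct [consumes 1, case_names zero add smult gen mult]:
  fixes P :: "('g, 'r::comm_ring_1) fa \<Rightarrow> bool"
  assumes "a \<in> fa_carrier"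
    and zero: "P fa_zero"
    and add: "\<And>a b. a \<in> fa_carrier \<Longrightarrow> b \<in> fa_carrier \<Longrightarrow> P a \<Longrightarrow> P b \<Longrightarrow> P (fa_add a b)"
    and smult: "\<And>c a. a \<in> fa_carrier \<Longrightarrow> P a \<Longrightarrow> P (fa_smult c a)"
    and gen: "\<And>g. P (fa_gen g)"
    and mult: "\<And>g a. a \<in> fa_carrier \<Longrightarrow> P a \<Longrightarrow> P (fa_mult (fa_gen g) a)"
  shows "P a"
proof -
  have word: "(fa_word u :: ('g, 'r) fa) \<in> fa_carrier \<and> P (fa_word u)" if "u \<noteq> []" for u
    using that
  proof (induction u rule: list_nonempty_induct)
    case (single g)
    have "fa_word [g] = (fa_gen g :: ('g, 'r) fa)" by (simp add: fa_word_def fa_gen_def)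
    then show ?case using gen[of g] by simp
  next
    case (cons g u)
    then show ?case unfolding fa_word_Cons using mult by simp
  qed
  define A where "A = {w. a w \<noteq> 0}"
  have A: "finite A" "[] \<notin> A" using assms(1) by (auto simp: A_def fa_carrier_def)
  have "fa_sum (\<lambda>u. fa_smult (a u) (fa_word u)) A \<in> fa_carrier \<and>
      P (fa_sum (\<lambda>u. fa_smult (a u) (fa_word u)) A)"
    using A
  proof (induction A)
    case empty
    then show ?case using zero by (simp add: fa_sum_empty)
  next
    case (insert u A)
    then have "(fa_word u :: ('g, 'r) fa) \<in> fa_carrier \<and> P (fa_word u)" by (intro word) auto
    then show ?case using insert by (simp add: fa_sum_insert add smult)
  qed
  moreover have "fa_sum (\<lambda>u. fa_smult (a u) (fa_word u)) A = a"
  proof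
    fix w
    have "fa_sum (\<lambda>u. fa_smult (a u) (fa_word u)) A w = (\<Sum>u\<in>A. if u = w then a w else 0)"
      unfolding fa_sum_def fa_smult_def fa_word_def by (rule sum.cong) auto
    also have "\<dots> = a w" using A by (auto simp: A_def)
    finally show "fa_sum (\<lambda>u. fa_smult (a u) (fa_word u)) A w = a w" .
  qed
  ultimately show ?thesis by simp
qed

text \<open>A function F selects for every set X of relations a representative in the algebra
  presented by X, and each component is compared modulo the ideal of its own index. The relation is
  partial because every component has to lie in \<open>fa_carrier\<close>.\<close>

definition presented_rel ::
  "(('g, 'r::comm_ring_1) fa set \<Rightarrow> ('g, 'r) fa) \<Rightarrow> (('g, 'r) fa set \<Rightarrow> ('g, 'r) fa) \<Rightarrow> bool" where
  "presented_rel F F' \<longleftrightarrow>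
     (\<forall>X. F X \<in> fa_carrier \<and> F' X \<in> fa_carrier \<and> fa_minus (F X) (F' X) \<in> fa_ideal X)"

lemma fa_ideal_refl: "fa_minus a a \<in> fa_ideal X"
  using fa_ideal.zero[of X] by (simp add: fa_minus_def fa_zero_def)

lemma fa_ideal_sym: "fa_minus a b \<in> fa_ideal X \<Longrightarrow> fa_minus b a \<in> fa_ideal X"
  using fa_ideal.smult[of "fa_minus a b" X "- 1"] by (simp add: fa_minus_def fa_smult_def)

lemma fa_ideal_trans:
  "fa_minus a b \<in> fa_ideal X \<Longrightarrow> fa_minus b c \<in> fa_ideal X \<Longrightarrow> fa_minus a c \<in> fa_ideal X"
  using fa_ideal.add[of "fa_minus a b" X "fa_minus b c"] by (simp add: fa_minus_def fa_add_def)

lemma fa_ideal_add: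
  "fa_minus a a' \<in> fa_ideal X \<Longrightarrow> fa_minus b b' \<in> fa_ideal X \<Longrightarrow>
     fa_minus (fa_add a b) (fa_add a' b') \<in> fa_ideal X"
  using fa_ideal.add[of "fa_minus a a'" X "fa_minus b b'"]
  by (simp add: fa_minus_def fa_add_def algebra_simps)

lemma fa_ideal_smult:
  "fa_minus a a' \<in> fa_ideal X \<Longrightarrow> fa_minus (fa_smult c a) (fa_smult c a') \<in> fa_ideal X"
  using fa_ideal.smult[of "fa_minus a a'" X c] by (simp add: fa_minus_def fa_smult_def algebra_simps)

lemma fa_ideal_mult:
  assumes "fa_minus a a' \<in> fa_ideal X" "fa_minus b b' \<in> fa_ideal X" "a' \<in> fa_carrier" "b \<in> fa_carrier"
  shows "fa_minus (fa_mult a b) (fa_mult a' b') \<in> fa_ideal X"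
proof -
  have minus: "fa_minus f g = fa_add f (fa_smult (- 1) g)" for f g :: "('a, 'b) fa"
    by (simp add: fa_minus_def fa_add_def fa_smult_def)
  \<comment> \<open>The usual splitting ab - a'b' = (a - a')b + a'(b - b').\<close>
  have "fa_minus (fa_mult a b) (fa_mult a' b') =
      fa_add (fa_mult (fa_minus a a') b) (fa_mult a' (fa_minus b b'))"
    unfolding minus fa_mult_add fa_mult_smult by (simp add: fa_add_def fa_smult_def)
  then show ?thesis using assms by (simp add: fa_ideal.intros)
qed

lemma presented_rel_partial: "part_equivp presented_rel"
proof (rule part_equivpI)
  show "\<exists>F. presented_rel F F"
    by (rule exI[of _ "\<lambda>_. fa_zero"]) (simp add: presented_rel_def fa_ideal_refl)
  show "symp presented_rel"
    by (auto simp: symp_def presented_rel_def fa_ideal_sym)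
  show "transp presented_rel"
    unfolding transp_def presented_rel_def using fa_ideal_trans by blast
qed

text \<open>A type cannot depend on the set \<open>X\<close> of relations. The product over all \<open>X\<close> of the algebras
  presented by \<open>X\<close> is a type that contains each of them as a direct factor, so that congruence
  modulo an ideal becomes equality in a ring.\<close>

quotient_type (overloaded) ('g, 'r) presented =
  "('g, 'r::comm_ring_1) fa set \<Rightarrow> ('g, 'r) fa" / partial: presented_rel
  by (rule presented_rel_partial)

instantiation presented :: (type, comm_ring_1) ring
begin

lift_definition zero_presented :: "('a, 'b) presented" is "\<lambda>_. fa_zero"
  by (simp add: presented_rel_def fa_ideal_refl)

lift_definition plus_presented :: "('a, 'b) presented \<Rightarrow> ('a, 'b) presented \<Rightarrow> ('a, 'b) presented"
  is "\<lambda>F F' X. fa_add (F X) (F' X)"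
  by (simp add: presented_rel_def fa_ideal_add)

lift_definition uminus_presented :: "('a, 'b) presented \<Rightarrow> ('a, 'b) presented"
  is "\<lambda>F X. fa_smult (- 1) (F X)"
  by (simp add: presented_rel_def fa_ideal_smult)

lift_definition times_presented :: "('a, 'b) presented \<Rightarrow> ('a, 'b) presented \<Rightarrow> ('a, 'b) presented"
  is "\<lambda>F F' X. fa_mult (F X) (F' X)"
  by (simp add: presented_rel_def fa_ideal_mult)

definition minus_presented :: "('a, 'b) presented \<Rightarrow> ('a, 'b) presented \<Rightarrow> ('a, 'b) presented" where
  "minus_presented a b = a + - b"

instance
proof
  fix a b c :: "('a, 'b) presented"
  show "a + b + c = a + (b + c)"
    by (transfer, simp add: presented_rel_def fa_add_group(1) fa_ideal_refl)
  show "a + b = b + a"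
    by (transfer, simp add: presented_rel_def fa_add_group(2) fa_ideal_refl)
  show "0 + a = a"
    by (transfer, simp add: presented_rel_def fa_add_group(3) fa_ideal_refl)
  show "- a + a = 0"
    by (transfer, simp add: presented_rel_def fa_add_group(4) fa_ideal_refl)
  show "a * b * c = a * (b * c)"
    by (transfer, simp add: presented_rel_def fa_mult_assoc fa_ideal_refl)
  show "(a + b) * c = a * c + b * c"
    by (transfer, simp add: presented_rel_def fa_mult_add(1) fa_ideal_refl)
  show "a * (b + c) = a * b + a * c"
    by (transfer, simp add: presented_rel_def fa_mult_add(2) fa_ideal_refl)
  show "a - b = a + - b" by (rule minus_presented_def)
qed

end

lift_definition scale_presented :: "'r::comm_ring_1 \<Rightarrow> ('g, 'r) presented \<Rightarrow> ('g, 'r) presented"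
  is "\<lambda>c F X. fa_smult c (F X)"
  by (simp add: presented_rel_def fa_ideal_smult)

text \<open>The embedding of the algebra presented by X as one factor of the product: all other
  components are 0. Elements outside \<open>fa_carrier\<close> are sent to 0 to stay in the domain
  of the relation.\<close>

lift_definition of_fa :: "('g, 'r::comm_ring_1) fa set \<Rightarrow> ('g, 'r) fa \<Rightarrow> ('g, 'r) presented"
  is "\<lambda>X a Y. if Y = X \<and> a \<in> fa_carrier then a else fa_zero"
  by (simp add: presented_rel_def fa_ideal_refl)

lemma module_scale_presented: "module scale_presented"
  by (unfold_locales; transfer; simp add: presented_rel_def fa_smult_module fa_ideal_refl)

lemma mult_scale_presented:
  "scale_presented c x * y = scale_presented c (x * y)"
  "x * scale_presented c y = scale_presented c (x * y)"
  by (transfer, simp add: presented_rel_def fa_mult_smult fa_ideal_refl)+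

lemma of_fa_zero [simp]: "of_fa X fa_zero = 0"
  by transfer (simp add: presented_rel_def fa_ideal_refl)

lemma of_fa_add:
  "a \<in> fa_carrier \<Longrightarrow> b \<in> fa_carrier \<Longrightarrow> of_fa X (fa_add a b) = of_fa X a + of_fa X b"
  by transfer (simp add: presented_rel_def fa_add_group fa_ideal_refl)

lemma of_fa_smult:
  "a \<in> fa_carrier \<Longrightarrow> of_fa X (fa_smult c a) = scale_presented c (of_fa X a)"
  by transfer (simp add: presented_rel_def fa_smult_zero fa_ideal_refl)

lemma of_fa_mult:
  "a \<in> fa_carrier \<Longrightarrow> b \<in> fa_carrier \<Longrightarrow> of_fa X (fa_mult a b) = of_fa X a * of_fa X b"
  by transfer (simp add: presented_rel_def fa_mult_zero fa_ideal_refl)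

lemma of_fa_sum:
  assumes "finite A" "\<And>x. x \<in> A \<Longrightarrow> F x \<in> fa_carrier"
  shows "of_fa X (fa_sum F A) = (\<Sum>x\<in>A. of_fa X (F x))"
  using assms
  by (induction A) (simp_all add: fa_sum_empty fa_sum_insert of_fa_add fa_sum_carrier)

text \<open>At every index other than X both sides are \<open>fa_zero\<close>, so only congruence at
  X remains.\<close>

lemma of_fa_eq_iff:
  assumes "a \<in> fa_carrier" "b \<in> fa_carrier"
  shows "of_fa X a = of_fa X b \<longleftrightarrow> fa_minus a b \<in> fa_ideal X"
  using assms by transfer (auto simp: presented_rel_def fa_ideal_refl)

section \<open>The center of the Kumjian-Pask algebra\<close>

lemma of_fa_relation:
  assumes "fa_minus a b \<in> X" "a \<in> fa_carrier" "b \<in> fa_carrier"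
  shows "of_fa X a = of_fa X b"
  using assms of_fa_eq_iff fa_ideal.base by blast

lemma kp_relations_generators:
  "v \<notin> kvert G \<Longrightarrow> fa_gen (GP v) \<in> kp_relations k G"
  "l \<notin> nonzero_paths G \<Longrightarrow> fa_gen (GS l) \<in> kp_relations k G"
  "l \<notin> nonzero_paths G \<Longrightarrow> fa_gen (GT l) \<in> kp_relations k G"
  unfolding kp_relations_def Let_def Un_iff mem_Collect_eq by blast+

lemma kp_relations_KP1:
  "v \<in> kvert G \<Longrightarrow> w \<in> kvert G \<Longrightarrow>
     fa_minus (fa_mult (fa_gen (GP v)) (fa_gen (GP w))) (if v = w then fa_gen (GP v) else fa_zero)
       \<in> kp_relations k G"
  unfolding kp_relations_def Let_def Un_iff mem_Collect_eq by blast

lemma kp_relations_KP2: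
  "l \<in> nonzero_paths G \<Longrightarrow> m \<in> nonzero_paths G \<Longrightarrow> krng G m = ksrc G l \<Longrightarrow>
     fa_minus (fa_mult (fa_gen (GS l)) (fa_gen (GS m))) (fa_gen (GS (kcomp G l m))) \<in> kp_relations k G"
  "l \<in> nonzero_paths G \<Longrightarrow> m \<in> nonzero_paths G \<Longrightarrow> krng G m = ksrc G l \<Longrightarrow>
     fa_minus (fa_mult (fa_gen (GT m)) (fa_gen (GT l))) (fa_gen (GT (kcomp G l m))) \<in> kp_relations k G"
  "l \<in> nonzero_paths G \<Longrightarrow>
     fa_minus (fa_mult (fa_gen (GP (krng G l))) (fa_gen (GS l))) (fa_gen (GS l)) \<in> kp_relations k G"
  "l \<in> nonzero_paths G \<Longrightarrow>
     fa_minus (fa_mult (fa_gen (GS l)) (fa_gen (GP (ksrc G l)))) (fa_gen (GS l)) \<in> kp_relations k G"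
  "l \<in> nonzero_paths G \<Longrightarrow>
     fa_minus (fa_mult (fa_gen (GP (ksrc G l))) (fa_gen (GT l))) (fa_gen (GT l)) \<in> kp_relations k G"
  "l \<in> nonzero_paths G \<Longrightarrow>
     fa_minus (fa_mult (fa_gen (GT l)) (fa_gen (GP (krng G l)))) (fa_gen (GT l)) \<in> kp_relations k G"
  unfolding kp_relations_def Let_def Un_iff mem_Collect_eq by blast+

lemma kp_relations_KP3:
  "l \<in> nonzero_paths G \<Longrightarrow> m \<in> nonzero_paths G \<Longrightarrow> kdeg G l = kdeg G m \<Longrightarrow>
     fa_minus (fa_mult (fa_gen (GT l)) (fa_gen (GS m)))
       (if l = m then fa_gen (GP (ksrc G l)) else fa_zero) \<in> kp_relations k G"
  unfolding kp_relations_def Let_def Un_iff mem_Collect_eq by blast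

lemma kp_relations_KP4:
  "v \<in> kvert G \<Longrightarrow> n \<in> Nk k \<Longrightarrow> n \<noteq> dzero \<Longrightarrow>
     fa_minus (fa_gen (GP v))
       (fa_sum (\<lambda>l. fa_mult (fa_gen (GS l)) (fa_gen (GT l))) (kpaths_from G v n)) \<in> kp_relations k G"
  unfolding kp_relations_def Let_def Un_iff mem_Collect_eq by blast

lemma kumjian_pask_family_of_fa:
  fixes k :: nat and G :: "'a kgraph"
  defines "\<phi> \<equiv> of_fa (kp_relations k G :: ('a kpgen, 'r::comm_ring_1) fa set)"
  assumes "is_kgraph k G" "row_finite k G" "no_sources k G"
  shows "kumjian_pask_family k G scale_presented
    (\<lambda>v. \<phi> (fa_gen (GP v))) (\<lambda>l. \<phi> (fa_gen (GS l))) (\<lambda>l. \<phi> (fa_gen (GT l)))"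
proof -
  interpret module "scale_presented :: 'r \<Rightarrow> ('a kpgen, 'r) presented \<Rightarrow> _"
    by (rule module_scale_presented)
  interpret higher_rank_graph k G by unfold_locales fact
  have rel: "\<phi> a = \<phi> b"
    if "fa_minus a b \<in> kp_relations k G" "a \<in> fa_carrier" "b \<in> fa_carrier" for a b
    unfolding \<phi>_def using that by (rule of_fa_relation)
  have mult: "\<phi> (fa_mult (fa_gen g) (fa_gen h)) = \<phi> (fa_gen g) * \<phi> (fa_gen h)" for g h
    unfolding \<phi>_def by (rule of_fa_mult) simp_all
  have zero: "\<phi> fa_zero = 0" unfolding \<phi>_def by simp
  show ?thesis
  proof unfold_locales
    show "row_finite k G" "no_sources k G" by fact+
  next
    fix c :: 'r and x y :: "('a kpgen, 'r) presented"
    show "scale_presented c x * y = scale_presented c (x * y)"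
      "x * scale_presented c y = scale_presented c (x * y)"
      by (rule mult_scale_presented)+
  next
    fix v w assume "v \<in> V" "w \<in> V"
    from rel[OF kp_relations_KP1[OF this]]
    show "\<phi> (fa_gen (GP v)) * \<phi> (fa_gen (GP w)) = (if v = w then \<phi> (fa_gen (GP v)) else 0)"
      by (cases "v = w") (simp_all add: mult zero)
  next
    fix l m assume "l \<in> nonzero_paths G" "m \<in> nonzero_paths G" "r m = src l"
    from rel[OF kp_relations_KP2(1)[OF this]] rel[OF kp_relations_KP2(2)[OF this]]
    show "\<phi> (fa_gen (GS l)) * \<phi> (fa_gen (GS m)) = \<phi> (fa_gen (GS (l \<odot> m)))"
      "\<phi> (fa_gen (GT m)) * \<phi> (fa_gen (GT l)) = \<phi> (fa_gen (GT (l \<odot> m)))"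
      by (simp_all add: mult)
  next
    fix l assume "l \<in> nonzero_paths G"
    from kp_relations_KP2(3-6)[OF this, THEN rel]
    show "\<phi> (fa_gen (GP (r l))) * \<phi> (fa_gen (GS l)) = \<phi> (fa_gen (GS l))"
      "\<phi> (fa_gen (GS l)) * \<phi> (fa_gen (GP (src l))) = \<phi> (fa_gen (GS l))"
      "\<phi> (fa_gen (GP (src l))) * \<phi> (fa_gen (GT l)) = \<phi> (fa_gen (GT l))"
      "\<phi> (fa_gen (GT l)) * \<phi> (fa_gen (GP (r l))) = \<phi> (fa_gen (GT l))"
      by (simp_all add: mult)
  next
    fix l m assume "l \<in> nonzero_paths G" "m \<in> nonzero_paths G" "d l = d m"
    from rel[OF kp_relations_KP3[OF this]]
    show "\<phi> (fa_gen (GT l)) * \<phi> (fa_gen (GS m)) = (if l = m then \<phi> (fa_gen (GP (src l))) else 0)"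
      by (cases "l = m") (simp_all add: mult zero)
  next
    fix v n assume v: "v \<in> V" "n \<in> Nk k" "n \<noteq> dzero"
    have fin: "finite (kpaths_from G v n)"
      using \<open>row_finite k G\<close> v unfolding row_finite_def by blast
    have "\<phi> (fa_gen (GP v)) = \<phi> (fa_sum (\<lambda>l. fa_mult (fa_gen (GS l)) (fa_gen (GT l))) (kpaths_from G v n))"
      by (rule rel[OF kp_relations_KP4[OF v]]) (simp_all add: fa_sum_carrier fin)
    also have "\<dots> = (\<Sum>l\<in>kpaths_from G v n. \<phi> (fa_mult (fa_gen (GS l)) (fa_gen (GT l))))"
      unfolding \<phi>_def by (rule of_fa_sum[OF fin]) simp
    finally show "\<phi> (fa_gen (GP v)) = (\<Sum>l\<in>kpaths_from G v n. \<phi> (fa_gen (GS l)) * \<phi> (fa_gen (GT l)))"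
      by (simp add: mult)
  qed
qed

theorem theorem4p7:
  fixes k :: nat and G :: "'a kgraph"
  assumes "1 \<le> k"
    and "is_kgraph k G"
    and "row_finite k G"
    and "no_sources k G"
  shows "(aperiodic k G \<and> cofinal k G \<and> finite (kvert G) \<longrightarrow>
            (\<exists>e :: ('a kpgen, 'r::comm_ring_1) fa. kp_is_identity k G e \<and>
               kp_center k G = {a \<in> fa_carrier. \<exists>r. kp_eq k G a (fa_smult r e)}))
       \<and> (cofinal k G \<and> infinite (kvert G) \<longrightarrow>
            kp_center k G = {a :: ('a kpgen, 'r::comm_ring_1) fa. a \<in> fa_carrier \<and> kp_eq k G a fa_zero})"
proof -
  define \<phi> where "\<phi> = of_fa (kp_relations k G :: ('a kpgen, 'r) fa set)"
  define p s t where "p v = \<phi> (fa_gen (GP v))" and "s v = \<phi> (fa_gen (GS v))"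
    and "t v = \<phi> (fa_gen (GT v))" for v
  interpret kumjian_pask_family k G scale_presented p s t
    using kumjian_pask_family_of_fa[OF assms(2-4)] unfolding p_def s_def t_def \<phi>_def .
  have eq_iff: "kp_eq k G a b \<longleftrightarrow> \<phi> a = \<phi> b" if "a \<in> fa_carrier" "b \<in> fa_carrier" for a b
    using of_fa_eq_iff[OF that] by (simp add: kp_eq_def kp_ideal_def \<phi>_def)
  have mult: "\<phi> (fa_mult a b) = \<phi> a * \<phi> b" if "a \<in> fa_carrier" "b \<in> fa_carrier" for a b
    using of_fa_mult[OF that] by (simp add: \<phi>_def)
  have smult: "\<phi> (fa_smult c a) = scale_presented c (\<phi> a)" if "a \<in> fa_carrier" for a c
    using of_fa_smult[OF that] by (simp add: \<phi>_def)
  have zero: "\<phi> fa_zero = 0" by (simp add: \<phi>_def)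
  \<comment> \<open>A generator indexed by something that is not a vertex, or not a path of nonzero
    degree, is itself a relation and so vanishes.\<close>
  have gen_zero: "\<phi> (fa_gen g) = 0" if "(fa_gen g :: ('a kpgen, 'r) fa) \<in> kp_relations k G" for g
  proof -
    have "fa_minus (fa_gen g) fa_zero = (fa_gen g :: ('a kpgen, 'r) fa)"
      by (simp add: fa_minus_def fa_zero_def)
    then have "\<phi> (fa_gen g) = \<phi> fa_zero"
      unfolding \<phi>_def using that by (intro of_fa_relation) simp_all
    then show ?thesis by (simp add: zero)
  qed
  have gen_cases: "\<phi> (fa_gen g) = 0 \<or> (\<exists>l\<in>\<Lambda>. \<phi> (fa_gen g) = S l \<or> \<phi> (fa_gen g) = T l)" for g
  proof (cases g)
    case (GP v)
    show ?thesis
    proof (cases "v \<in> V")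
      case True
      then have "\<phi> (fa_gen g) = S v" by (simp add: GP p_def)
      then show ?thesis using vert_mor[OF True] by blast
    next
      case False
      then show ?thesis unfolding GP using gen_zero[OF kp_relations_generators(1)] by blast
    qed
  next
    case (GS l)
    show ?thesis
    proof (cases "l \<in> nonzero_paths G")
      case True
      then have "l \<in> \<Lambda>" "l \<notin> V" using nonzero_pathsD by blast+
      moreover from this(2) have "\<phi> (fa_gen g) = S l" by (simp add: GS s_def S_def)
      ultimately show ?thesis by blast
    next
      case False
      then show ?thesis unfolding GS using gen_zero[OF kp_relations_generators(2)] by blast
    qed
  next
    case (GT l)
    show ?thesis
    proof (cases "l \<in> nonzero_paths G")
      case True
      then have "l \<in> \<Lambda>" "l \<notin> V" using nonzero_pathsD by blast+
      moreover from this(2) have "\<phi> (fa_gen g) = T l" by (simp add: GT t_def T_def)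
      ultimately show ?thesis by blast
    next
      case False
      then show ?thesis unfolding GT using gen_zero[OF kp_relations_generators(3)] by blast
    qed
  qed
  have in_span: "\<phi> a \<in> span normal_forms" if "a \<in> fa_carrier" for a
    using that
  proof (induction a rule: fa_carrier_induct)
    case zero
    show ?case using span_zero by (simp add: \<phi>_def)
  next
    case (add a b)
    then show ?case using span_add of_fa_add[of a b] by (simp add: \<phi>_def)
  next
    case (smult c a)
    then show ?case using span_scale of_fa_smult[of a] by (simp add: \<phi>_def)
  next
    case (gen g)
    show ?case using gen_cases[of g] generators_in_span span_zero by metis
  next
    case (mult g a)
    then have "\<phi> (fa_mult (fa_gen g) a) = \<phi> (fa_gen g) * \<phi> a"
      by (simp add: \<phi>_def of_fa_mult)
    then show ?case using gen_cases[of g] generator_mult_span mult.IH span_zero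
      by (metis mult_zero_left)
  qed
  have centralI: "central (\<phi> a)" if "a \<in> kp_center k G" for a
  proof -
    \<comment> \<open>The locale predicate \<open>central\<close> demands commutation with
      generators only, so it suffices to test a against single letters.\<close>
    have comm: "\<phi> a * \<phi> (fa_gen g) = \<phi> (fa_gen g) * \<phi> a" for g
    proof -
      have "kp_eq k G (fa_mult a (fa_gen g)) (fa_mult (fa_gen g) a)" "a \<in> fa_carrier"
        using that by (simp_all add: kp_center_def)
      then show ?thesis using eq_iff mult by simp
    qed
    have "S l = \<phi> (fa_gen (if l \<in> V then GP l else GS l))"
      "T l = \<phi> (fa_gen (if l \<in> V then GP l else GT l))" for l
      by (simp_all add: S_def T_def p_def s_def t_def)
    then show ?thesis unfolding central_def using comm by simp
  qed
  \<comment> \<open>Serves both converse inclusions, with x the image of the identity in the first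
    part and with x and c equal to 0 in the second.\<close>
  have scalar_central: "a \<in> kp_center k G"
    if a: "a \<in> fa_carrier" and x: "\<phi> a = scale_presented c x"
      and unit: "\<And>b. b \<in> fa_carrier \<Longrightarrow> x * \<phi> b = \<phi> b * x" for a c x
    using a x unit by (simp add: kp_center_def eq_iff mult)
  have part1: "\<exists>e :: ('a kpgen, 'r) fa. kp_is_identity k G e \<and>
      kp_center k G = {a \<in> fa_carrier. \<exists>r. kp_eq k G a (fa_smult r e)}"
    if h: "aperiodic k G" "cofinal k G" "finite V"
  proof -
    define e :: "('a kpgen, 'r) fa" where "e = fa_sum (\<lambda>v. fa_gen (GP v)) V"
    have e: "e \<in> fa_carrier" "\<phi> e = sum p V"
      using h(3) by (simp_all add: e_def fa_sum_carrier \<phi>_def of_fa_sum p_def)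
    have unit: "\<phi> b * \<phi> e = \<phi> b" "\<phi> e * \<phi> b = \<phi> b" if b: "b \<in> fa_carrier" for b
    proof -
      obtain F where "F \<subseteq> V"
        "\<And>F'. finite F' \<Longrightarrow> F \<subseteq> F' \<Longrightarrow> F' \<subseteq> V \<Longrightarrow> \<phi> b * sum p F' = \<phi> b \<and> sum p F' * \<phi> b = \<phi> b"
        using span_local_unit[OF in_span[OF b]] by metis
      \<comment> \<open>As \<open>V\<close> is finite, it is itself an admissible set for the local
        unit of every b.\<close>
      then show "\<phi> b * \<phi> e = \<phi> b" "\<phi> e * \<phi> b = \<phi> b" using h(3) e(2) by simp_all
    qed
    have "kp_is_identity k G e"
      using e(1) unit by (simp add: kp_is_identity_def eq_iff mult)
    moreover have "a \<in> kp_center k G \<longleftrightarrow> a \<in> fa_carrier \<and> (\<exists>c. kp_eq k G a (fa_smult c e))" for a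
    proof
      assume a: "a \<in> kp_center k G"
      then have "a \<in> fa_carrier" by (simp add: kp_center_def)
      moreover from this obtain c where "\<phi> a = scale_presented c (sum p V)"
        using central_scalar[OF h centralI[OF a] in_span] by blast
      ultimately show "a \<in> fa_carrier \<and> (\<exists>c. kp_eq k G a (fa_smult c e))"
        using e by (auto simp: eq_iff smult)
    next
      assume "a \<in> fa_carrier \<and> (\<exists>c. kp_eq k G a (fa_smult c e))"
      then obtain c where "a \<in> fa_carrier" "\<phi> a = scale_presented c (\<phi> e)"
        using e by (auto simp: eq_iff smult)
      then show "a \<in> kp_center k G" by (rule scalar_central) (simp add: unit)
    qed
    ultimately show ?thesis by blast
  qed
  have part2: "kp_center k G = {a :: ('a kpgen, 'r) fa. a \<in> fa_carrier \<and> kp_eq k G a fa_zero}"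
    if h: "cofinal k G" "infinite V"
  proof -
    have "a \<in> kp_center k G \<longleftrightarrow> a \<in> fa_carrier \<and> kp_eq k G a fa_zero" for a :: "('a kpgen, 'r) fa"
    proof
      assume a: "a \<in> kp_center k G"
      then have "a \<in> fa_carrier" by (simp add: kp_center_def)
      then show "a \<in> fa_carrier \<and> kp_eq k G a fa_zero"
        using central_zero[OF h centralI[OF a] in_span] by (simp add: eq_iff zero)
    next
      assume a: "a \<in> fa_carrier \<and> kp_eq k G a fa_zero"
      then have "\<phi> a = scale_presented 0 0" using eq_iff[of a fa_zero] by (simp add: zero)
      then show "a \<in> kp_center k G" using a scalar_central[of a 0 0] by simp
    qed
    then show ?thesis by blast
  qed
  show ?thesis using part1 part2 by blast
qed

end
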